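(* Consider the linearized power network described in the context, with representative machine $g_0(s)$, rating matrix $F=\mathrm{diag}(f_1,\dots,f_n)$, network Laplacian $L$, and a step disturbance $u(t)=u_0\mathbf{1}_{t\ge 0}$, $u_0\in\mathbb{R}^n$. Assume that $g_i(s)=\frac{1}{f_i}g_0(s)$ with $f_i>0$ for every bus $i$, and that for each $k=1,\dots,n-1$ the transfer function $h_k(s)=\frac{g_0(s)}{1+\lambda_k g_0(s)}$ has all its poles in $\mathrm{Re}[s]<0$. Let $\tilde w(t)$ be the vector of bus frequency deviations from the system frequency (defined in the context). Then $$\|\tilde w\|_2^2:=\int_0^\infty |\tilde w(t)|^2\,dt = z_0^T Y z_0,$$ where $z_0:=V_\perp^T F^{-1/2}u_0\in\mathbb{R}^{n-1}$ and $Y\in\mathbb{R}^{(n-1)\times(n-1)}$ is the matrix with entries $$y_{kl}=\gamma_{kl}\,\langle h_k,h_l\rangle=\gamma_{kl}\int_0^\infty h_k(t)h_l(t)\,dt,\qquad k,l=1,\dots,n-1,$$ with $\Gamma=(\gamma_{kl}):=V_\perp^T F^{-1}V_\perp$.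
   Context: There are $n$ generator buses. Bus $i$ has a scalar transfer function $g_i(s)$ from net power $u_i-p^e_i$ to phase angle $\theta_i$. The electrical power drawn from the network is $p^e=L\theta$, where $L\in\mathbb{R}^{n\times n}$ is a symmetric positive semidefinite weighted graph Laplacian of rank $n-1$ with kernel spanned by the all-ones vector $\mathbf{1}$. The frequencies are $w_i=\dot\theta_i$. The function $g_0(s)$ is a real, rational, strictly proper scalar transfer function. Set $L_F:=F^{-1/2}LF^{-1/2}$ and diagonalize it as $L_F=V\Lambda V^T$ with $V$ real orthogonal and $\Lambda=\mathrm{diag}(\lambda_0,\dots,\lambda_{n-1})$, $0=\lambda_0<\lambda_1\le\dots\le\lambda_{n-1}$. Write $V=[v_0\ \ V_\perp]$, where $v_0=(\sum_i f_i)^{-1/2}F^{1/2}\mathbf{1}$ is the unit eigenvector for the eigenvalue $0$ and $V_\perp\in\mathbb{R}^{n\times(n-1)}$ has as columns the orthonormal eigenvectors for $\lambda_1,\dots,\lambda_{n-1}$. For $k=0,1,\dots,n-1$ let $h_k(s)=\frac{g_0(s)}{1+\lambda_k g_0(s)}$, and let $h_k(t)$, $t\ge 0$, be its inverse Laplace transform (impulse response). The response of the vector of frequencies to the step disturbance has Laplace transform $w(s)=F^{-1/2}V\,\mathrm{diag}(h_0(s),\dots,h_{n-1}(s))\,V^TF^{-1/2}u_0$. It decomposes as $w(t)=\bar w(t)\mathbf{1}+\tilde w(t)$, where the system frequency $\bar w$ has Laplace transform $\bar w(s)=\frac{\sum_i u_{0i}}{\sum_i f_i}g_0(s)$, and the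 deviation term $\tilde w$ has Laplace transform $$\tilde w(s)=F^{-1/2}V_\perp\,\mathrm{diag}(h_1(s),\dots,h_{n-1}(s))\,V_\perp^TF^{-1/2}u_0.$$ $|\cdot|$ denotes the Euclidean norm. *)

theory Defs
  imports
    "HOL-Complex_Analysis.Complex_Singularities"
    "Jordan_Normal_Form.DL_Rank"
    "Jordan_Normal_Form.Matrix_Kernel"
begin

unbundle no vec_syntax
unbundle no inner_syntax

definition eucl_norm :: "real vec \<Rightarrow> real" where
  "eucl_norm v = L2_set (\<lambda>i. v $ i) {0..<dim_vec v}"

definition ones_vec :: "nat \<Rightarrow> real vec" where
  "ones_vec n = Matrix.vec n (\<lambda>_. 1)"

definition pos_semidef_mat :: "nat \<Rightarrow> real mat \<Rightarrow> bool" where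
  "pos_semidef_mat n A \<longleftrightarrow>
     A \<in> carrier_mat n n \<and> (\<forall>x \<in> carrier_vec n. 0 \<le> x \<bullet> (A *\<^sub>v x))"

definition weighted_graph_laplacian :: "nat \<Rightarrow> real mat \<Rightarrow> bool" where
  "weighted_graph_laplacian n L \<longleftrightarrow>
     (\<exists>a :: nat \<Rightarrow> nat \<Rightarrow> real.
        (\<forall>i<n. \<forall>j<n. a i j = a j i \<and> 0 \<le> a i j) \<and>
        L = Matrix.mat n n (\<lambda>(i, j). if i = j then (\<Sum>k \<in> {0..<n} - {i}. a i k) else - a i j))"

text \<open>
  Transfer functions are total functions on the complex plane. At a root of the denominator the
  value is junk (\<open>x / 0 = 0\<close>); everything below depends on the values only far to the right, or,
  through \<^const>\<open>is_pole\<close>, on a punctured neighbourhood.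
  The zero function is included, by taking \<open>p = 0\<close>.
\<close>

definition real_rational_strictly_proper :: "(complex \<Rightarrow> complex) \<Rightarrow> bool" where
  "real_rational_strictly_proper g \<longleftrightarrow>
     (\<exists>p q :: real poly. degree p < degree q \<and>
        (\<forall>s. g s = poly (map_poly complex_of_real p) s / poly (map_poly complex_of_real q) s))"

text \<open>
  \<open>has_laplace f F\<close>: the signal \<open>f\<close>, of which only the restriction to \<open>t \<ge> 0\<close> matters, has the
  one-sided Laplace transform \<open>F\<close> on some right half-plane, with absolute convergence. Thus \<open>f\<close> is
  an inverse Laplace transform of \<open>F\<close>; by Lerch's theorem it is determined by \<open>F\<close> up to a
  null subset of \<open>{0..}\<close>.
\<close>

definition has_laplace :: "(real \<Rightarrow> real) \<Rightarrow> (complex \<Rightarrow> complex) \<Rightarrow> bool" where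
  "has_laplace f F \<longleftrightarrow>
     (\<exists>a::real. \<forall>s::complex. a < Re s \<longrightarrow>
        set_integrable lborel {0..} (\<lambda>t. exp (- s * complex_of_real t) * complex_of_real (f t)) \<and>
        (LBINT t:{0..}. exp (- s * complex_of_real t) * complex_of_real (f t)) = F s)"

definition transfers :: "(complex \<Rightarrow> complex) \<Rightarrow> (real \<Rightarrow> real) \<Rightarrow> (real \<Rightarrow> real) \<Rightarrow> bool" where
  "transfers g x y \<longleftrightarrow> (\<exists>X. has_laplace x X \<and> has_laplace y (\<lambda>s. g s * X s))"

text \<open>
  The closed loop of the buses with the network, for the net power input \<open>u\<close>, phase angles
  \<open>\<theta>\<close> and frequencies \<open>w\<close>: bus \<open>i\<close> maps \<open>u\<^sub>i - (L \<theta>)\<^sub>i\<close> to \<open>\<theta>\<^sub>i\<close>, and \<open>w\<^sub>i\<close> is the time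
  derivative of \<open>\<theta>\<^sub>i\<close>. Transfer functions describe deviations from an equilibrium, hence the
  initial condition \<open>\<theta> 0 = 0\<close> (the Laplace transform of \<open>w\<^sub>i\<close> is \<open>s\<close> times that of \<open>\<theta>\<^sub>i\<close>).
\<close>

definition network_response ::
  "nat \<Rightarrow> (nat \<Rightarrow> complex \<Rightarrow> complex) \<Rightarrow> real mat \<Rightarrow> (real \<Rightarrow> real vec)
     \<Rightarrow> (real \<Rightarrow> real vec) \<Rightarrow> (real \<Rightarrow> real vec) \<Rightarrow> bool" where
  "network_response n g L u \<theta> w \<longleftrightarrow>
     (\<forall>t\<ge>0. \<theta> t \<in> carrier_vec n \<and> w t \<in> carrier_vec n) \<and>
     \<theta> 0 = 0\<^sub>v n \<and>
     (\<forall>i<n. transfers (g i) (\<lambda>t. (u t - L *\<^sub>v \<theta> t) $ i) (\<lambda>t. \<theta> t $ i)) \<and>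
     (\<forall>i<n. \<forall>t\<ge>0. ((\<lambda>\<tau>. \<theta> \<tau> $ i) has_real_derivative w t $ i) (at t within {0..}))"

definition step_input :: "real vec \<Rightarrow> real \<Rightarrow> real vec" where
  "step_input u0 t = indicat_real {0..} t \<cdot>\<^sub>v u0"

definition modal_tf :: "(complex \<Rightarrow> complex) \<Rightarrow> real \<Rightarrow> complex \<Rightarrow> complex" where
  "modal_tf g0 \<mu> s = g0 s / (1 + complex_of_real \<mu> * g0 s)"

definition drop_first_col :: "'a mat \<Rightarrow> 'a mat" where
  "drop_first_col V = Matrix.mat (dim_row V) (dim_col V - 1) (\<lambda>(i, j). V $$ (i, Suc j))"

text \<open>
  The matrix \<open>Y\<close>. Its rows and columns, like those of \<open>\<Gamma>\<close>, are numbered from 0, while the modes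
  that enter are \<open>1, \<dots>, n - 1\<close>; hence the shift in \<open>h\<close>.
\<close>

definition gram_weighted :: "nat \<Rightarrow> real mat \<Rightarrow> (nat \<Rightarrow> real \<Rightarrow> real) \<Rightarrow> real mat" where
  "gram_weighted n \<Gamma> h =
     Matrix.mat (n - 1) (n - 1)
       (\<lambda>(k, l). \<Gamma> $$ (k, l) * (LBINT t:{0..}. h (Suc k) t * h (Suc l) t))"

end

theory Submission
  imports Defs
    "HOL-Probability.Levy"
    "HOL-Computational_Algebra.Field_as_Ring"
    "HOL-Computational_Algebra.Fundamental_Theorem_Algebra"
begin

unbundle no vec_syntax
unbundle no inner_syntax

text \<open>
  In the coordinates \<open>V\<^sup>T F\<^sup>1\<^sup>/\<^sup>2 \<theta>\<close> the closed loop decouples, and the step response of the \<open>k\<close>-th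
  coordinate has the transform \<open>c\<^sub>k h\<^sub>k(s) / s\<close>. A strictly proper rational function has a
  continuous inverse transform \<open>\<eta>\<^sub>k\<close>, an exponential polynomial which decays if the poles are
  stable. Laplace transforms are injective up to null sets, so the coordinate is \<open>c\<^sub>k\<close> times the
  primitive of \<open>\<eta>\<^sub>k\<close>; the frequencies are therefore everywhere combinations of the continuous
  \<open>c\<^sub>k \<eta>\<^sub>k\<close>, and \<open>\<eta>\<^sub>k = h\<^sub>k\<close> almost everywhere. The mode \<open>k = 0\<close> is the system frequency, and the
  energy of the remaining ones is a quadratic form in the \<open>h\<^sub>k\<close>.
\<close>

section \<open>Injectivity of the Laplace transform\<close>

text \<open>The data give little pointwise information: \<open>h k\<close> and \<open>wbar\<close>
  are arbitrary functions with prescribed transforms, hence known only up to null sets, and neither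
  continuity nor growth of \<open>w\<close> is assumed. So no transform of \<open>w\<close> is ever
  formed. The angles are differentiable, hence continuous, and for them equality of transforms
  becomes equality at every time; differentiating that equality gives \<open>w\<close>. Decay cannot
  be read off a transform that is known only far to the right. The inverse transform is therefore
  built root by root together with a bound C exp (b t). The stability hypothesis speaks of poles,
  not of roots of a denominator; cancelling common factors makes the two agree. Injectivity comes
  from Levy's uniqueness theorem for characteristic functions: on a vertical line Re s = \<sigma>
  the Laplace transform of f is the Fourier transform of exp (- \<sigma> t) f t, cut off at
  0.\<close>

lemma real_distribution_density:
  fixes p :: "real \<Rightarrow> real"
  assumes "integrable lborel p" "\<And>x. 0 \<le> p x" "integral\<^sup>L lborel p = 1"
  shows "real_distribution (density lborel p)"
proof -
  have [measurable]: "p \<in> borel_measurable borel"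
    using assms(1) by simp
  have "emeasure (density lborel p) (space (density lborel p)) = (\<integral>\<^sup>+x. ennreal (p x) \<partial>lborel)"
    by (simp add: emeasure_density)
  also have "\<dots> = 1"
    using assms by (subst nn_integral_eq_integral) auto
  finally show ?thesis
    unfolding real_distribution_def real_distribution_axioms_def
    by (auto intro: prob_spaceI)
qed

text \<open>The positive and the negative part of p have the same Fourier transform. Normalised to
  probability densities they have the same characteristic function, so they agree almost
  everywhere.\<close>

lemma fourier_transform_zero_imp_AE_zero:
  fixes p :: "real \<Rightarrow> real"
  assumes int: "integrable lborel p"
    and zero: "\<And>\<omega>. (CLBINT x. p x *\<^sub>R iexp (\<omega> * x)) = 0"
  shows "AE x in lborel. p x = 0"
proof -
  define P where "P = (\<lambda>x. max 0 (p x))"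
  define N where "N = (\<lambda>x. max 0 (- p x))"
  define m where "m = integral\<^sup>L lborel P"
  have [measurable]: "p \<in> borel_measurable borel"
    using int by simp
  have P: "integrable lborel P" and N: "integrable lborel N"
    unfolding P_def N_def using int by auto
  have [measurable]: "P \<in> borel_measurable borel" "N \<in> borel_measurable borel"
    unfolding P_def N_def by measurable
  have nonneg: "0 \<le> P x" "0 \<le> N x" and diff: "p x = P x - N x" for x
    unfolding P_def N_def by auto
  have int_exp: "complex_integrable lborel (\<lambda>x. q x *\<^sub>R iexp (\<omega> * x))"
    if "integrable lborel q" for q \<omega>
  proof (rule Bochner_Integration.integrable_bound[OF that])
    have [measurable]: "q \<in> borel_measurable borel" using that by simp
    show "(\<lambda>x. q x *\<^sub>R iexp (\<omega> * x)) \<in> borel_measurable lborel" by measurable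
  qed auto
  have eq: "(CLBINT x. P x *\<^sub>R iexp (\<omega> * x)) = (CLBINT x. N x *\<^sub>R iexp (\<omega> * x))" for \<omega>
  proof -
    have "(CLBINT x. P x *\<^sub>R iexp (\<omega> * x)) - (CLBINT x. N x *\<^sub>R iexp (\<omega> * x))
        = (CLBINT x. p x *\<^sub>R iexp (\<omega> * x))"
      using int_exp[OF P] int_exp[OF N]
      by (subst Bochner_Integration.integral_diff[symmetric]) (auto simp: diff scaleR_diff_left)
    then show ?thesis using zero by simp
  qed
  \<comment> \<open>At frequency 0 the transform is the total mass, so one constant m normalises
    both parts. If m = 0, both vanish almost everywhere.\<close>
  have mN: "integral\<^sup>L lborel N = m"
    using eq[of 0] P N unfolding m_def
    by (simp add: scaleR_conv_of_real del: of_real_eq_iff) (simp add: of_real_eq_iff)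
  have "AE x in lborel. P x = N x"
  proof (cases "m = 0")
    case True
    then have "AE x in lborel. P x = 0" "AE x in lborel. N x = 0"
      using P N mN nonneg integral_nonneg_eq_0_iff_AE[of lborel P] integral_nonneg_eq_0_iff_AE[of lborel N]
      by (simp_all add: m_def)
    then show ?thesis by eventually_elim simp
  next
    case False
    then have m: "m > 0"
      using nonneg integral_nonneg_AE[of P lborel] by (auto simp: m_def less_le)
    have dP: "real_distribution (density lborel (\<lambda>x. ennreal (P x / m)))"
      and dN: "real_distribution (density lborel (\<lambda>x. ennreal (N x / m)))"
      using P N mN m nonneg by (auto intro!: real_distribution_density simp: m_def)
    have ch: "char (density lborel (\<lambda>x. ennreal (q x / m))) \<omega> = (CLBINT x. q x *\<^sub>R iexp (\<omega> * x)) / m"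
      if [measurable]: "q \<in> borel_measurable borel" and "\<And>x. 0 \<le> q x" for q \<omega>
    proof -
      have "char (density lborel (\<lambda>x. ennreal (q x / m))) \<omega>
          = (CLBINT x. (q x / m) *\<^sub>R iexp (\<omega> * x))"
        unfolding char_def using m that by (subst integral_density) auto
      also have "\<dots> = (CLBINT x. (q x *\<^sub>R iexp (\<omega> * x)) / m)"
        by (simp add: scaleR_conv_of_real)
      also have "\<dots> = (CLBINT x. q x *\<^sub>R iexp (\<omega> * x)) / m"
        by simp
      finally show ?thesis .
    qed
    have "density lborel (\<lambda>x. ennreal (P x / m)) = density lborel (\<lambda>x. ennreal (N x / m))"
      by (rule Levy_uniqueness[OF dP dN]) (use eq in \<open>simp add: fun_eq_iff ch nonneg\<close>)
    then have "AE x in lborel. ennreal (P x / m) = ennreal (N x / m)"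
      by (subst (asm) sigma_finite_measure.density_unique_iff[OF sigma_finite_lborel]) auto
    then show ?thesis
      by eventually_elim (use m nonneg in simp)
  qed
  then show ?thesis
    by eventually_elim (simp add: diff)
qed

text \<open>Integrability and value are stated together, at a single point s, so that the algebraic
  rules need no common half-plane. Signals are complex because the roots of a real denominator may
  be.\<close>

definition laplace_at :: "(real \<Rightarrow> complex) \<Rightarrow> complex \<Rightarrow> complex \<Rightarrow> bool" where
  "laplace_at f s F \<longleftrightarrow>
     has_bochner_integral lborel (\<lambda>t. indicator {0..} t *\<^sub>R (exp (- s * of_real t) * f t)) F"

text \<open>Each signal comes with its own half-plane of convergence; as eventualities along a
  filter, finitely many of them combine without naming abscissas.\<close>

definition right_half :: "complex filter" where
  "right_half = filtercomap Re at_top"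

lemma eventually_right_half: "eventually P right_half \<longleftrightarrow> (\<exists>a. \<forall>s. a < Re s \<longrightarrow> P s)"
  unfolding right_half_def by (rule eventually_filtercomap_at_top_dense)

lemma eventually_right_half_gt: "eventually (\<lambda>s. a < Re s) right_half"
  by (auto simp: eventually_right_half)

lemma has_laplace_iff_laplace_at:
  "has_laplace f F \<longleftrightarrow> eventually (\<lambda>s. laplace_at (\<lambda>t. of_real (f t)) s (F s)) right_half"
  by (auto simp: has_laplace_def laplace_at_def eventually_right_half has_bochner_integral_iff
      set_integrable_def set_lebesgue_integral_def)

lemma laplace_at_cmult:
  assumes "laplace_at f s F"
  shows "laplace_at (\<lambda>t. c * f t) s (c * F)"
  using has_bochner_integral_mult_right[OF assms[unfolded laplace_at_def], of c]
  by (simp add: laplace_at_def algebra_simps)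

lemma laplace_at_diff:
  "laplace_at f s F \<Longrightarrow> laplace_at g s G \<Longrightarrow> laplace_at (\<lambda>t. f t - g t) s (F - G)"
  unfolding laplace_at_def
  by (drule (1) has_bochner_integral_diff) (simp add: algebra_simps)

lemma laplace_at_sum:
  "(\<And>i. i \<in> I \<Longrightarrow> laplace_at (f i) s (F i)) \<Longrightarrow> laplace_at (\<lambda>t. \<Sum>i\<in>I. f i t) s (\<Sum>i\<in>I. F i)"
  unfolding laplace_at_def
  by (drule has_bochner_integral_sum) (simp add: sum_distrib_left scaleR_sum_right)

lemma laplace_at_cong:
  "(\<And>t. 0 \<le> t \<Longrightarrow> f t = g t) \<Longrightarrow> laplace_at f s F \<longleftrightarrow> laplace_at g s F"
  unfolding laplace_at_def by (intro has_bochner_integral_cong) (auto simp: indicator_def)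

lemma laplace_at_unique: "laplace_at f s F \<Longrightarrow> laplace_at f s G \<Longrightarrow> F = G"
  unfolding laplace_at_def by (rule has_bochner_integral_eq)

lemma laplace_at_cnj: "laplace_at f s F \<Longrightarrow> laplace_at (\<lambda>t. cnj (f t)) (cnj s) (cnj F)"
  unfolding laplace_at_def
  by (drule has_bochner_integral_cnj) (simp add: exp_cnj)

text \<open>
  Since \<open>2 Re f = f + cnj f\<close> and conjugation reflects the line \<open>Re s = \<sigma>\<close> onto itself, vanishing
  on the whole line passes from \<open>f\<close> to its real part.
\<close>

lemma laplace_zero_imp_AE_Re_zero:
  assumes zero: "\<And>\<omega>. laplace_at f (Complex \<sigma> \<omega>) 0"
  shows "AE t in lborel. 0 \<le> t \<longrightarrow> Re (f t) = 0"
proof -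
  define p where "p = (\<lambda>t. indicat_real {0..} t * (exp (- \<sigma> * t) * Re (f t)))"
  have lap: "has_bochner_integral lborel (\<lambda>t. p t *\<^sub>R iexp (\<omega> * t)) 0" for \<omega>
  proof -
    \<comment> \<open>The ordinate is - \<omega> because exp (- s t) then equals exp (- \<sigma> t)
      \<open>iexp (\<omega> * t)\<close>. The sum f + cnj f is written as a difference to fit the
      rule for differences.\<close>
    have "laplace_at (\<lambda>t. (1/2) * (f t - (-1) * cnj (f t))) (Complex \<sigma> (- \<omega>)) ((1/2) * (0 - (-1) * cnj 0))"
      using laplace_at_cnj[OF zero[of \<omega>]] zero[of "- \<omega>"]
      by (intro laplace_at_cmult laplace_at_diff) (simp_all add: complex_cnj)
    moreover have "exp (- Complex \<sigma> (- \<omega>) * of_real t) * ((1/2) * (f t - (-1) * cnj (f t)))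
        = (exp (- \<sigma> * t) * Re (f t)) *\<^sub>R iexp (\<omega> * t)" for t
    proof -
      have "(1/2) * (f t - (-1) * cnj (f t)) = of_real (Re (f t))"
        by (simp add: complex_add_cnj)
      moreover have "exp (- Complex \<sigma> (- \<omega>) * of_real t) = of_real (exp (- \<sigma> * t)) * iexp (\<omega> * t)"
        by (simp add: complex_eq_iff Re_exp Im_exp)
      ultimately show ?thesis by (simp add: scaleR_conv_of_real mult_ac)
    qed
    ultimately show ?thesis
      unfolding laplace_at_def p_def by (simp only: scaleR_scaleR) simp
  qed
  have "integrable lborel (\<lambda>t. Re (p t *\<^sub>R iexp (0 * t)))"
    using lap[of 0] by (intro integrable_Re) (simp add: has_bochner_integral_iff)
  then have "integrable lborel p" by simp
  then have "AE t in lborel. p t = 0"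
    by (rule fourier_transform_zero_imp_AE_zero) (use lap in \<open>simp add: has_bochner_integral_iff\<close>)
  then show ?thesis
    by eventually_elim (auto simp: p_def)
qed

lemma laplace_eq_imp_AE_eq:
  assumes "eventually (\<lambda>s. laplace_at f s (F s)) right_half"
    and "eventually (\<lambda>s. laplace_at g s (F s)) right_half"
  shows "AE t in lborel. 0 \<le> t \<longrightarrow> f t = g t"
proof -
  have "eventually (\<lambda>s. laplace_at (\<lambda>t. f t - g t) s 0) right_half"
    using assms by eventually_elim (drule (1) laplace_at_diff, simp)
  then obtain a where a: "\<And>s. a < Re s \<Longrightarrow> laplace_at (\<lambda>t. f t - g t) s 0"
    by (auto simp: eventually_right_half)
  \<comment> \<open>The factor c lets the result on real parts serve twice: c = 1 gives the real
    part, c = - i the imaginary part of the difference.\<close>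
  have "AE t in lborel. 0 \<le> t \<longrightarrow> Re (c * (f t - g t)) = 0" for c
    using laplace_at_cmult[OF a, of _ c] by (intro laplace_zero_imp_AE_Re_zero[of _ "a + 1"]) simp
  from this[of 1] this[of "- \<i>"] show ?thesis
    by eventually_elim (auto simp: complex_eq_iff)
qed

section \<open>Inverse transforms of rational functions\<close>

lemma has_vector_derivative_integral_half_line:
  fixes f :: "real \<Rightarrow> 'a::banach"
  assumes "continuous_on {0..} f" "0 \<le> t"
  shows "((\<lambda>u. integral {0..u} f) has_vector_derivative f t) (at t within {0..})"
proof -
  have "at t within {0..t + 1} = at t within {0..}"
    by (rule at_within_nhd[of t "{..<t + 1}"]) auto
  moreover have "((\<lambda>u. integral {0..u} f) has_vector_derivative f t) (at t within {0..t + 1})"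
    using assms by (intro integral_has_vector_derivative continuous_on_subset[OF assms(1)]) auto
  ultimately show ?thesis by simp
qed

lemma integrable_exp_decay_half_line:
  fixes a :: real
  assumes "a < 0"
  shows "integrable lborel (\<lambda>t. indicat_real {0..} t * exp (a * t))"
proof -
  have "(\<lambda>t. exp (a * t)) absolutely_integrable_on {0..}"
    using integrable_on_exp_minus_to_infinity[of "- a" 0] assms
    by (intro nonnegative_absolutely_integrable_1) auto
  then show ?thesis
    unfolding set_integrable_def by (subst (asm) integrable_completion) auto
qed

lemma integrable_exp_bound:
  fixes f :: "real \<Rightarrow> complex"
  assumes "continuous_on {0..} f" and "\<And>t. 0 \<le> t \<Longrightarrow> norm (f t) \<le> C * exp (b * t)" and "b < Re s"
  shows "integrable lborel (\<lambda>t. indicator {0..} t *\<^sub>R (exp (- s * of_real t) * f t))"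
proof (rule Bochner_Integration.integrable_bound)
  show "integrable lborel (\<lambda>t. C * (indicat_real {0..} t * exp ((b - Re s) * t)))"
    using integrable_exp_decay_half_line[of "b - Re s"] assms(3) by simp
  show "(\<lambda>t. indicator {0..} t *\<^sub>R (exp (- s * of_real t) * f t)) \<in> borel_measurable lborel"
    using assms(1) by (auto intro!: borel_measurable_continuous_on_indicator continuous_intros)
  have "exp (- (Re s * t)) * norm (f t) \<le> C * exp ((b - Re s) * t)" if "0 \<le> t" for t
  proof -
    have "exp (- (Re s * t)) * norm (f t) \<le> exp (- (Re s * t)) * (C * exp (b * t))"
      using assms(2)[OF that] by simp
    also have "\<dots> = C * exp ((b - Re s) * t)"
      by (simp add: exp_add[symmetric] algebra_simps)
    finally show ?thesis .
  qed
  then show "AE t in lborel. norm (indicator {0..} t *\<^sub>R (exp (- s * of_real t) * f t))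
      \<le> norm (C * (indicat_real {0..} t * exp ((b - Re s) * t)))"
    by (intro AE_I2) (auto simp: indicator_def norm_mult intro: order_trans[OF _ abs_ge_self])
qed

text \<open>Transforms integrate over the closed half-line, the fundamental theorem for interval
  integrals over the open one.\<close>

lemma integral_atLeast_eq_greaterThan:
  fixes f :: "real \<Rightarrow> complex"
  shows "integral\<^sup>L lborel (\<lambda>t. indicator {a..} t *\<^sub>R f t) = (LBINT t:{a<..}. f t)"
  unfolding set_lebesgue_integral_def
  by (rule integral_discrete_difference[of "{a}"]) (auto simp: indicator_def)

text \<open>Integrate the derivative of exp (- s t) f t over the half-line: the boundary term at 0
  is f 0, and the one at infinity vanishes by the growth bound, since b < Re s. The same bound makes
  the transform of f exist.\<close>

lemma laplace_at_derivative:
  fixes f f' :: "real \<Rightarrow> complex"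
  assumes cont: "continuous_on {0..} f" "continuous_on {0..} f'"
    and deriv: "\<And>t. 0 < t \<Longrightarrow> (f has_vector_derivative f' t) (at t)"
    and bound: "\<And>t. 0 \<le> t \<Longrightarrow> norm (f t) \<le> C * exp (b * t)"
    and s: "b < Re s"
    and F': "laplace_at f' s F'"
  shows "\<exists>F. laplace_at f s F \<and> F' = s * F - f 0"
proof -
  define G where "G = (\<lambda>t. exp (- s * of_real t) * f t)"
  define G' where "G' = (\<lambda>t. exp (- s * of_real t) * f' t - s * (exp (- s * of_real t) * f t))"
  obtain F where F: "laplace_at f s F"
    using integrable_exp_bound[OF cont(1) bound s]
    by (auto simp: laplace_at_def has_bochner_integral_iff)
  have lap: "has_bochner_integral lborel (\<lambda>t. indicator {0..} t *\<^sub>R G' t) (F' - s * F)"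
    using laplace_at_diff[OF F' laplace_at_cmult[OF F, of s]]
    unfolding laplace_at_def G'_def by (simp add: algebra_simps)
  have "(LBINT t=ereal 0..\<infinity>. G' t) = 0 - G 0"
  proof (rule interval_integral_FTC_integrable)
    have "set_integrable lborel {0..} G'"
      using lap by (simp add: set_integrable_def has_bochner_integral_iff)
    then show "set_integrable lborel (einterval (ereal 0) \<infinity>) G'"
      by (rule set_integrable_subset) (auto simp: einterval_def)
    show "(G has_vector_derivative G' t) (at t)" if "ereal 0 < ereal t" for t
    proof -
      have "((\<lambda>t. exp (- s * of_real t)) has_vector_derivative (- s * exp (- s * of_real t))) (at t)"
        by (rule has_vector_derivative_real_field) (auto intro!: derivative_eq_intros)
      then show ?thesis
        unfolding G_def G'_def using has_vector_derivative_mult[OF _ deriv[of t], of "\<lambda>t. exp (- s * of_real t)"] that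
        by (fastforce simp: mult.assoc)
    qed
    show "isCont G' t" if "ereal 0 < ereal t" for t
    proof -
      have "continuous_on {0<..} G'"
        unfolding G'_def
        by (intro continuous_intros continuous_on_subset[OF cont(1)] continuous_on_subset[OF cont(2)]) auto
      then show ?thesis using that by (simp add: continuous_on_eq_continuous_at)
    qed
    have "continuous_on {0..} G"
      unfolding G_def by (intro continuous_intros cont)
    then have "(G \<longlongrightarrow> G 0) (at 0 within {0..})"
      by (simp add: continuous_on_def)
    then show "((G \<circ> real_of_ereal) \<longlongrightarrow> G 0) (at_right (ereal 0))"
      unfolding ereal_tendsto_simps by (rule tendsto_within_subset) auto
    have "((\<lambda>t. C * exp ((b - Re s) * t)) \<longlongrightarrow> C * 0) at_top"
      using s
      by (intro tendsto_mult tendsto_const filterlim_compose[OF exp_at_bot]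
          filterlim_tendsto_neg_mult_at_bot[OF tendsto_const] filterlim_ident) auto
    then have "((\<lambda>t. C * exp ((b - Re s) * t)) \<longlongrightarrow> 0) at_top" by simp
    then have "(G \<longlongrightarrow> 0) at_top"
    proof (rule Lim_null_comparison[rotated])
      show "eventually (\<lambda>t. norm (G t) \<le> C * exp ((b - Re s) * t)) at_top"
        using eventually_ge_at_top[of 0]
      proof eventually_elim
        case (elim t)
        have "norm (G t) \<le> exp (- (Re s * t)) * (C * exp (b * t))"
          unfolding G_def using bound[OF elim] by (simp add: norm_mult)
        also have "\<dots> = C * exp ((b - Re s) * t)"
          by (simp add: exp_add[symmetric] algebra_simps)
        finally show ?case .
      qed
    qed
    then show "((G \<circ> real_of_ereal) \<longlongrightarrow> 0) (at_left \<infinity>)"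
      unfolding ereal_tendsto_simps .
  qed auto
  then have "F' - s * F = - f 0"
    using lap by (simp add: interval_integral_to_infinity_eq G_def has_bochner_integral_iff
        integral_atLeast_eq_greaterThan)
  then show ?thesis using F by (auto simp: algebra_simps)
qed

text \<open>Variation of constants for y' = r y + \<phi>, y 0 = \<alpha>. Because Re r is strictly
  below b, the rate b of the input is inherited by the output; repeated roots therefore never force
  polynomial factors into the bound.\<close>

lemma first_order_response:
  fixes \<phi> :: "real \<Rightarrow> complex"
  assumes cont: "continuous_on {0..} \<phi>" and bound: "\<And>t. 0 \<le> t \<Longrightarrow> norm (\<phi> t) \<le> C * exp (b * t)"
    and r: "Re r < b"
  shows "\<exists>y K. continuous_on {0..} y \<and>
    (\<forall>t\<ge>0. (y has_vector_derivative (r * y t + \<phi> t)) (at t within {0..})) \<and>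
    (\<forall>t\<ge>0. norm (y t) \<le> K * exp (b * t)) \<and>
    (\<forall>s \<Phi>. b < Re s \<longrightarrow> laplace_at \<phi> s \<Phi> \<longrightarrow> laplace_at y s ((\<alpha> + \<Phi>) / (s - r)))"
proof -
  define J where "J = (\<lambda>t. integral {0..t} (\<lambda>\<tau>. exp (- r * of_real \<tau>) * \<phi> \<tau>))"
  define y where "y = (\<lambda>t. exp (r * of_real t) * (\<alpha> + J t))"
  have cont': "continuous_on {0..} (\<lambda>\<tau>. exp (- r * of_real \<tau>) * \<phi> \<tau>)"
    by (intro continuous_intros cont)
  have deriv: "(y has_vector_derivative (r * y t + \<phi> t)) (at t within {0..})" if "0 \<le> t" for t
  proof -
    have J: "(J has_vector_derivative (exp (- r * of_real t) * \<phi> t)) (at t within {0..})"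
      unfolding J_def by (rule has_vector_derivative_integral_half_line[OF cont' that])
    have "((\<lambda>t. exp (r * of_real t)) has_vector_derivative (r * exp (r * of_real t))) (at t within {0..})"
      by (rule has_vector_derivative_real_field) (auto intro!: derivative_eq_intros)
    then have "(y has_vector_derivative (exp (r * of_real t) * (0 + exp (- r * of_real t) * \<phi> t)
        + r * exp (r * of_real t) * (\<alpha> + J t))) (at t within {0..})"
      unfolding y_def by (intro has_vector_derivative_mult has_vector_derivative_add J has_vector_derivative_const)
    moreover have "exp (r * of_real t) * (0 + exp (- r * of_real t) * \<phi> t)
        + r * exp (r * of_real t) * (\<alpha> + J t) = r * y t + \<phi> t"
      by (simp add: y_def exp_minus)
    ultimately show ?thesis by simp
  qed
  have cont_y: "continuous_on {0..} y"
    using deriv by (intro continuous_on_vector_derivative) auto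
  have y0: "y 0 = \<alpha>" by (simp add: y_def J_def)
  \<comment> \<open>The first term bounds the free motion from \<alpha>. The second comes from
    integrating C exp ((b - Re r) \<tau>), the bound for the integrand of \<open>J\<close>.\<close>
  define K where "K = norm \<alpha> + C / (b - Re r)"
  have C: "0 \<le> C" using bound[of 0] order_trans[OF norm_ge_zero] by fastforce
  have bound_y: "norm (y t) \<le> K * exp (b * t)" if t: "0 \<le> t" for t
  proof -
    define E where "E = (\<lambda>\<tau>. C / (b - Re r) * exp ((b - Re r) * \<tau>))"
    have E: "((\<lambda>\<tau>. C * exp ((b - Re r) * \<tau>)) has_integral (E t - E 0)) {0..t}"
      using r t unfolding E_def
      by (intro fundamental_theorem_of_calculus)
        (auto intro!: derivative_eq_intros simp: has_real_derivative_iff_has_vector_derivative[symmetric])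
    have "norm (J t) \<le> integral {0..t} (\<lambda>\<tau>. C * exp ((b - Re r) * \<tau>))"
      unfolding J_def
    proof (rule Henstock_Kurzweil_Integration.integral_norm_bound_integral)
      show "(\<lambda>\<tau>. exp (- r * of_real \<tau>) * \<phi> \<tau>) integrable_on {0..t}"
        by (rule integrable_continuous_real, rule continuous_on_subset[OF cont']) auto
      show "(\<lambda>\<tau>. C * exp ((b - Re r) * \<tau>)) integrable_on {0..t}"
        using E by blast
      show "norm (exp (- r * of_real \<tau>) * \<phi> \<tau>) \<le> C * exp ((b - Re r) * \<tau>)" if "\<tau> \<in> {0..t}" for \<tau>
      proof -
        have "norm (exp (- r * of_real \<tau>) * \<phi> \<tau>) \<le> exp (- (Re r * \<tau>)) * (C * exp (b * \<tau>))"
          using bound[of \<tau>] that by (simp add: norm_mult)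
        also have "\<dots> = C * exp ((b - Re r) * \<tau>)"
          by (simp add: exp_add[symmetric] algebra_simps)
        finally show ?thesis .
      qed
    qed
    also have "\<dots> = E t - E 0" by (rule integral_unique[OF E])
    also have "\<dots> \<le> E t" using C r by (simp add: E_def)
    finally have J: "norm (J t) \<le> E t" .
    have "1 \<le> exp ((b - Re r) * t)" using r t by simp
    then have "norm \<alpha> \<le> norm \<alpha> * exp ((b - Re r) * t)"
      using mult_left_mono[of 1 "exp ((b - Re r) * t)" "norm \<alpha>"] by simp
    then have "norm (\<alpha> + J t) \<le> K * exp ((b - Re r) * t)"
      using J norm_triangle_ineq[of \<alpha> "J t"] unfolding K_def E_def distrib_right by linarith
    then have "norm (y t) \<le> exp (Re r * t) * (K * exp ((b - Re r) * t))"
      unfolding y_def by (simp add: norm_mult)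
    also have "\<dots> = K * exp (b * t)"
      by (simp add: exp_add[symmetric] algebra_simps)
    finally show ?thesis .
  qed
  have lap: "laplace_at y s ((\<alpha> + \<Phi>) / (s - r))" if s: "b < Re s" and \<Phi>: "laplace_at \<phi> s \<Phi>" for s \<Phi>
  proof -
    obtain Y where Y: "laplace_at y s Y"
      using integrable_exp_bound[OF cont_y bound_y s]
      by (auto simp: laplace_at_def has_bochner_integral_iff)
    have "laplace_at (\<lambda>t. r * y t - (-1) * \<phi> t) s (r * Y - (-1) * \<Phi>)"
      by (intro laplace_at_diff laplace_at_cmult Y \<Phi>)
    then have Y': "laplace_at (\<lambda>t. r * y t + \<phi> t) s (r * Y + \<Phi>)" by simp
    \<comment> \<open>The right-hand side of the equation is transformed once by linearity and once
      as the derivative of y. Comparison gives a linear equation for \<open>Y\<close>, solvable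
      since Re r < b < Re s.\<close>
    have "\<exists>F. laplace_at y s F \<and> r * Y + \<Phi> = s * F - y 0"
    proof (rule laplace_at_derivative[OF cont_y _ _ bound_y s Y'])
      show "continuous_on {0..} (\<lambda>t. r * y t + \<phi> t)"
        by (intro continuous_intros cont cont_y)
      show "(y has_vector_derivative (r * y t + \<phi> t)) (at t)" if "0 < t" for t
      proof -
        have "at t within {0..} = at t"
          using that by (intro at_within_interior) auto
        then show ?thesis using deriv[of t] that by simp
      qed
    qed auto
    then have "r * Y + \<Phi> = s * Y - \<alpha>"
      using laplace_at_unique[OF Y] y0 by auto
    moreover have "s \<noteq> r" using s r by auto
    ultimately have "Y = (\<alpha> + \<Phi>) / (s - r)"
      by (simp add: field_simps)
    then show ?thesis using Y by simp
  qed
  show ?thesis using cont_y deriv bound_y lap by (intro exI[of _ y] exI[of _ K]) simp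
qed

text \<open>
  Splitting off a root \<open>r\<close> of \<open>Q\<close> writes \<open>P / Q\<close> as \<open>(\<alpha> + R / Q') / (s - r)\<close>, the output of a
  first-order system driven by the inverse transform of \<open>R / Q'\<close>.
\<close>

lemma rational_inverse_laplace:
  fixes P Q :: "complex poly"
  assumes "Q \<noteq> 0" "P = 0 \<or> degree P < degree Q" "\<And>r. poly Q r = 0 \<Longrightarrow> Re r < b"
  shows "\<exists>\<eta> C. continuous_on {0..} \<eta> \<and> (\<forall>t\<ge>0. norm (\<eta> t) \<le> C * exp (b * t)) \<and>
    (\<forall>s. b < Re s \<longrightarrow> laplace_at \<eta> s (poly P s / poly Q s))"
  using assms
proof (induction "degree Q" arbitrary: P Q)
  \<comment> \<open>A nonzero constant Q leaves only P = 0, for which degree P < degree Q fails;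
    hence the disjunction in the hypothesis.\<close>
  case 0
  then have "P = 0" by simp
  then show ?case
    by (intro exI[of _ "\<lambda>_. 0"] exI[of _ 0]) (simp add: laplace_at_def has_bochner_integral_zero)
next
  case (Suc d)
  have "\<not> constant (poly Q)" using Suc.hyps(2) by (metis constant_degree nat.distinct(1))
  from fundamental_theorem_of_algebra[OF this] obtain r where r: "poly Q r = 0" ..
  then obtain Q' where Q: "Q = [:- r, 1:] * Q'" by (auto simp: poly_eq_0_iff_dvd)
  have Q': "Q' \<noteq> 0" using Suc.prems(1) Q by auto
  have "degree Q = degree [:- r, 1:] + degree Q'"
    unfolding Q using Q' by (intro degree_mult_eq) auto
  then have dQ': "d = degree Q'" using Suc.hyps(2) by simp
  have roots: "Re x < b" if "poly Q' x = 0" for x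
    using Suc.prems(3)[of x] that by (simp add: Q)
  define R where "R = P mod Q'"
  have PR: "P = P div Q' * Q' + R" by (simp add: R_def)
  have R: "R = 0 \<or> degree R < degree Q'" using degree_mod_less[OF Q'] by (simp add: R_def)
  \<comment> \<open>The degree of P is at most that of Q', so the quotient is a constant; it becomes
    the initial value \<alpha> of the first-order system.\<close>
  have "degree (P div Q') = 0"
  proof (cases "P div Q' = 0")
    case False
    have "degree (P div Q') + degree Q' = degree (P div Q' * Q')"
      using False Q' by (simp add: degree_mult_eq)
    also have "P div Q' * Q' = P - R" using PR by (simp add: algebra_simps)
    also have "degree (P - R) \<le> degree Q'"
      using R Suc.prems(2) Suc.hyps(2) dQ' by (intro degree_diff_le) auto
    finally show ?thesis by simp
  qed simp
  then obtain \<alpha> where \<alpha>: "P div Q' = [:\<alpha>:]" by (auto elim: degree_eq_zeroE)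
  obtain \<phi> C where \<phi>: "continuous_on {0..} \<phi>" "\<And>t. 0 \<le> t \<Longrightarrow> norm (\<phi> t) \<le> C * exp (b * t)"
      "\<And>s. b < Re s \<Longrightarrow> laplace_at \<phi> s (poly R s / poly Q' s)"
    using Suc.hyps(1)[OF dQ' Q' R roots] by blast
  have "\<exists>y K. continuous_on {0..} y \<and>
      (\<forall>t\<ge>0. (y has_vector_derivative (r * y t + \<phi> t)) (at t within {0..})) \<and>
      (\<forall>t\<ge>0. norm (y t) \<le> K * exp (b * t)) \<and>
      (\<forall>s \<Phi>. b < Re s \<longrightarrow> laplace_at \<phi> s \<Phi> \<longrightarrow> laplace_at y s ((\<alpha> + \<Phi>) / (s - r)))"
    by (intro first_order_response[where C = C, OF \<phi>(1) _ Suc.prems(3)[OF r]] \<phi>(2))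
  then obtain y K where y: "continuous_on {0..} y" "\<forall>t\<ge>0. norm (y t) \<le> K * exp (b * t)"
      "\<forall>s \<Phi>. b < Re s \<longrightarrow> laplace_at \<phi> s \<Phi> \<longrightarrow> laplace_at y s ((\<alpha> + \<Phi>) / (s - r))"
    by (elim exE conjE)
  have "laplace_at y s (poly P s / poly Q s)" if s: "b < Re s" for s
  proof -
    have "poly Q' s \<noteq> 0" using roots[of s] s by auto
    then have "\<alpha> + poly R s / poly Q' s = (\<alpha> * poly Q' s + poly R s) / poly Q' s"
      by (simp add: add_divide_distrib)
    also have "\<alpha> * poly Q' s + poly R s = poly P s" by (subst PR) (simp add: \<alpha>)
    finally have "poly P s / poly Q s = (\<alpha> + poly R s / poly Q' s) / (s - r)"
      by (simp add: Q algebra_simps)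
    then show ?thesis using y(3) s \<phi>(3)[OF s] by simp
  qed
  then show ?case using y(1,2) by blast
qed

section \<open>Poles of rational functions and the modal transfer functions\<close>

lemma finite_Re_bound:
  assumes "finite A" "\<And>z. z \<in> A \<Longrightarrow> Re z < c"
  obtains b where "b < c" "\<And>z. z \<in> A \<Longrightarrow> Re z < b"
proof (cases "A = {}")
  case True
  then show thesis using that[of "c - 1"] by simp
next
  case False
  define m where "m = Max (Re ` A)"
  have "m \<in> Re ` A" "\<And>z. z \<in> A \<Longrightarrow> Re z \<le> m"
    using assms(1) False by (auto simp: m_def intro: Max_in)
  then show thesis using assms(2) that[of "(m + c) / 2"] by fastforce
qed

lemma eventually_at_not_in_finite:
  fixes z :: "'a::t1_space"
  shows "finite A \<Longrightarrow> eventually (\<lambda>x. x \<notin> A) (at z)"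
  using islimpt_finite islimpt_iff_eventually by blast

text \<open>A root of Q that is cancelled by P need not be a pole of G and may lie anywhere. After
  division by the gcd every root of the denominator is a pole, so the hypothesis on poles locates
  all of them.\<close>

lemma rational_coprime_stable:
  fixes P Q :: "complex poly"
  assumes Q: "Q \<noteq> 0" and deg: "degree P < degree Q"
    and S: "finite S" "\<And>s. s \<notin> S \<Longrightarrow> G s = poly P s / poly Q s"
    and stable: "\<And>s. is_pole G s \<Longrightarrow> Re s < c"
  obtains P' Q' T where "Q' \<noteq> 0" "P' = 0 \<or> degree P' < degree Q'" "\<And>s. poly Q' s = 0 \<Longrightarrow> Re s < c"
    "finite T" "\<And>s. s \<notin> T \<Longrightarrow> G s = poly P' s / poly Q' s"
proof -
  define d where "d = gcd P Q"
  have d: "d \<noteq> 0" using Q by (simp add: d_def)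
  then obtain P' Q' where PQ: "P = P' * d" "Q = Q' * d" "coprime P' Q'"
    using gcd_coprime_exists[of P Q] unfolding d_def by blast
  have Q': "Q' \<noteq> 0" using Q PQ by auto
  \<comment> \<open>At a root of d the quotient P / Q is 0 by convention and may differ from P' /
    Q'. Such finitely many points are invisible to \<open>is_pole\<close>, which looks at punctured
    neighbourhoods.\<close>
  define T where "T = S \<union> {s. poly d s = 0}"
  have T: "finite T" using S(1) d by (simp add: T_def poly_roots_finite)
  have G: "G s = poly P' s / poly Q' s" if "s \<notin> T" for s
    using that S(2)[of s] by (simp add: T_def PQ)
  have "Re r < c" if r: "poly Q' r = 0" for r
  proof (rule stable)
    have "poly P' r \<noteq> 0"
    proof
      assume "poly P' r = 0"
      with r have "[:- r, 1:] dvd P'" "[:- r, 1:] dvd Q'" by (simp_all add: poly_eq_0_iff_dvd)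
      with PQ(3) have "is_unit [:- r, 1:]" by (rule coprime_common_divisor)
      then show False by (simp add: is_unit_iff_degree)
    qed
    moreover have "eventually (\<lambda>s. s \<notin> {s. poly Q' s = 0}) (at r)"
      using Q' by (intro eventually_at_not_in_finite) (simp add: poly_roots_finite)
    then have "filterlim (poly Q') (at 0) (at r)"
      using r poly_isCont[of r Q'] by (auto simp: filterlim_at isCont_def elim: eventually_mono)
    ultimately have "is_pole (\<lambda>s. poly P' s / poly Q' s) r"
      by (intro is_pole_divide) auto
    moreover have "eventually (\<lambda>s. s \<notin> T) (at r)"
      using T by (rule eventually_at_not_in_finite)
    then have "eventually (\<lambda>s. poly P' s / poly Q' s = G s) (at r)"
      by eventually_elim (simp add: G)
    ultimately show "is_pole G r" by (metis is_pole_cong)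
  qed
  moreover have "P' = 0 \<or> degree P' < degree Q'"
    using deg d Q' by (cases "P' = 0") (simp_all add: PQ degree_mult_eq)
  ultimately show thesis using that Q' T G by blast
qed

text \<open>With g0 = p / q the quotient is p / (q + \<mu> p), and strict properness of g0 keeps the
  degree of the denominator equal to that of q. The roots of q belong to the exceptional set as
  well, since \<open>g0\<close> has the default value 0 there. The last conclusion is what allows
  the closed loop to be solved.\<close>

lemma modal_tf_rational:
  assumes "real_rational_strictly_proper g0"
  obtains Q P S where "Q \<noteq> 0" "degree P < degree Q" "finite S"
    "\<And>s. s \<notin> S \<Longrightarrow> modal_tf g0 \<mu> s = poly P s / poly Q s"
    "\<And>s. s \<notin> S \<Longrightarrow> 1 + of_real \<mu> * g0 s \<noteq> 0"
proof -
  obtain p q :: "real poly" where deg: "degree p < degree q"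
    and g0: "\<And>s. g0 s = poly (map_poly of_real p) s / poly (map_poly of_real q) s"
    using assms by (auto simp: real_rational_strictly_proper_def)
  define P where "P = map_poly complex_of_real p"
  define Q0 where "Q0 = map_poly complex_of_real q"
  define Q where "Q = Q0 + Polynomial.smult (of_real \<mu>) P"
  have degPQ0: "degree P < degree Q0" using deg by (simp add: P_def Q0_def degree_map_poly)
  then have "degree Q = degree Q0"
    unfolding Q_def by (intro degree_add_eq_left) (auto intro: le_less_trans[OF degree_smult_le])
  then have degPQ: "degree P < degree Q" using degPQ0 by simp
  then have Q: "Q \<noteq> 0" by auto
  define S where "S = {s. poly Q0 s = 0} \<union> {s. poly Q s = 0}"
  have "finite S"
    using degPQ0 Q unfolding S_def by (intro finite_UnI poly_roots_finite) auto
  moreover have one_plus: "1 + of_real \<mu> * g0 s = poly Q s / poly Q0 s" if "s \<notin> S" for s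
    using that by (simp add: S_def g0 Q_def P_def Q0_def field_simps)
  moreover have "modal_tf g0 \<mu> s = poly P s / poly Q s" if "s \<notin> S" for s
    using that one_plus[OF that] by (simp add: S_def modal_tf_def g0 P_def Q0_def)
  moreover have "1 + of_real \<mu> * g0 s \<noteq> 0" if "s \<notin> S" for s
    using that one_plus[OF that] by (simp add: S_def)
  ultimately show thesis by (intro that[OF Q degPQ]) auto
qed

lemma eventually_right_half_not_in_finite:
  assumes "finite S" shows "eventually (\<lambda>s. s \<notin> S) right_half"
proof -
  obtain a where "\<And>z. z \<in> S \<Longrightarrow> Re z \<le> a"
    using bdd_above_finite[of "Re ` S"] assms by (auto simp: bdd_above_def)
  then show ?thesis unfolding eventually_right_half by (intro exI[of _ a]) force
qed

text \<open>The last conclusion is an implication because mode 0, on which no stability is imposed,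
  needs an inverse transform too. For stable modes the reduced fraction is inverted; otherwise any
  rate beyond the roots of the unreduced denominator will do.\<close>

lemma modal_tf_inverse_laplace:
  assumes "real_rational_strictly_proper g0"
  obtains \<eta> C b where "continuous_on {0..} \<eta>" "\<And>t. 0 \<le> t \<Longrightarrow> norm (\<eta> t) \<le> C * exp (b * t)"
    "eventually (\<lambda>s. laplace_at \<eta> s (modal_tf g0 \<mu> s)) right_half"
    "(\<forall>s. is_pole (modal_tf g0 \<mu>) s \<longrightarrow> Re s < 0) \<longrightarrow> b < 0"
proof -
  obtain P0 Q0 S0 where PQ0: "Q0 \<noteq> 0" "degree P0 < degree Q0" "finite S0"
    "\<And>s. s \<notin> S0 \<Longrightarrow> modal_tf g0 \<mu> s = poly P0 s / poly Q0 s"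
    by (rule modal_tf_rational[OF assms, where \<mu> = \<mu>]) metis
  have "\<exists>P Q b S. Q \<noteq> 0 \<and> (P = 0 \<or> degree P < degree Q) \<and> (\<forall>s. poly Q s = 0 \<longrightarrow> Re s < b)
      \<and> finite S \<and> (\<forall>s. s \<notin> S \<longrightarrow> modal_tf g0 \<mu> s = poly P s / poly Q s)
      \<and> ((\<forall>s. is_pole (modal_tf g0 \<mu>) s \<longrightarrow> Re s < 0) \<longrightarrow> b < 0)"
  proof (cases "\<forall>s. is_pole (modal_tf g0 \<mu>) s \<longrightarrow> Re s < 0")
    case True
    then obtain P Q S where PQ: "Q \<noteq> 0" "P = 0 \<or> degree P < degree Q" "\<And>s. poly Q s = 0 \<Longrightarrow> Re s < 0"
      "finite S" "\<And>s. s \<notin> S \<Longrightarrow> modal_tf g0 \<mu> s = poly P s / poly Q s"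
      using rational_coprime_stable[OF PQ0, of 0] by metis
    \<comment> \<open>Finitely many roots in the open left half-plane keep a distance from the
      imaginary axis; this gap is the exponential decay.\<close>
    obtain b where "b < 0" "\<And>z. z \<in> {s. poly Q s = 0} \<Longrightarrow> Re z < b"
      using finite_Re_bound[of "{s. poly Q s = 0}" 0] poly_roots_finite[OF PQ(1)] PQ(3) by auto
    with PQ show ?thesis by blast
  next
    case False
    have "eventually (\<lambda>s. s \<notin> {s. poly Q0 s = 0}) right_half"
      using eventually_right_half_not_in_finite[OF poly_roots_finite[OF PQ0(1)]] by blast
    then obtain a where "\<And>s. a < Re s \<Longrightarrow> poly Q0 s \<noteq> 0" by (auto simp: eventually_right_half)
    then have "\<forall>s. poly Q0 s = 0 \<longrightarrow> Re s < a + 1" by force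
    with PQ0 False show ?thesis by blast
  qed
  then obtain P Q b S where PQ: "Q \<noteq> 0" "P = 0 \<or> degree P < degree Q" "\<And>s. poly Q s = 0 \<Longrightarrow> Re s < b"
      "finite S" "\<And>s. s \<notin> S \<Longrightarrow> modal_tf g0 \<mu> s = poly P s / poly Q s"
      "(\<forall>s. is_pole (modal_tf g0 \<mu>) s \<longrightarrow> Re s < 0) \<longrightarrow> b < 0"
    by blast
  obtain \<eta> C where \<eta>: "continuous_on {0..} \<eta>" "\<forall>t\<ge>0. norm (\<eta> t) \<le> C * exp (b * t)"
    "\<forall>s. b < Re s \<longrightarrow> laplace_at \<eta> s (poly P s / poly Q s)"
    using rational_inverse_laplace[OF PQ(1-3)] by blast
  have "eventually (\<lambda>s. laplace_at \<eta> s (modal_tf g0 \<mu> s)) right_half"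
    using eventually_right_half_not_in_finite[OF PQ(4)] eventually_right_half_gt[of b]
    by eventually_elim (use \<eta>(3) PQ(5) in auto)
  then show thesis using that \<eta> PQ(6) by blast
qed

section \<open>Modal decomposition of the network\<close>

text \<open>If f and g differ at t, they differ on an interval to the right of t, which has positive
  measure. Working to the right covers the end point t = a.\<close>

lemma AE_eq_continuous_imp_eq_half_line:
  fixes f g :: "real \<Rightarrow> 'a::real_normed_vector"
  assumes cont: "continuous_on {a..} f" "continuous_on {a..} g"
    and AE: "AE t in lborel. a \<le> t \<longrightarrow> f t = g t" and t: "a \<le> t"
  shows "f t = g t"
proof (rule ccontr)
  assume "f t \<noteq> g t"
  have "continuous_on {a..} (\<lambda>x. f x - g x)" by (intro continuous_intros cont)
  then have "((\<lambda>x. f x - g x) \<longlongrightarrow> f t - g t) (at t within {a..})"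
    using t by (simp add: continuous_on_def)
  then have "((\<lambda>x. f x - g x) \<longlongrightarrow> f t - g t) (at_right t)"
    by (rule tendsto_within_subset) (use t in auto)
  then have "eventually (\<lambda>x. f x - g x \<noteq> 0) (at_right t)"
    using \<open>f t \<noteq> g t\<close> by (intro tendsto_imp_eventually_ne) auto
  then obtain c where c: "t < c" "\<And>x. t < x \<Longrightarrow> x < c \<Longrightarrow> f x \<noteq> g x"
    unfolding eventually_at_right_field by auto
  have "AE x in lborel. x \<notin> {t<..<c}"
    using AE by eventually_elim (use c t in force)
  then have "emeasure lborel {t<..<c} = 0"
    by (subst (asm) AE_iff_measurable[of "{t<..<c}"]) auto
  then show False using c by simp
qed

text \<open>A signal is an arbitrary function; its measurability on the half-line is hidden in the
  integrability of exp (- c t) f t and is recovered by multiplying with exp (c t).\<close>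

lemma has_laplace_measurable:
  assumes "has_laplace f F"
  shows "(\<lambda>t. indicat_real {0..} t * f t) \<in> borel_measurable borel"
proof -
  obtain a where a: "\<And>s. a < Re s \<Longrightarrow> laplace_at (\<lambda>t. of_real (f t)) s (F s)"
    using assms by (auto simp: has_laplace_iff_laplace_at eventually_right_half)
  define c where "c = a + 1"
  define \<phi> where "\<phi> = (\<lambda>t. indicator {0..} t *\<^sub>R (exp (- of_real c * of_real t) * complex_of_real (f t)))"
  have [measurable]: "\<phi> \<in> borel_measurable borel"
    using a[of "of_real c"] unfolding c_def \<phi>_def laplace_at_def has_bochner_integral_iff
    by (auto dest: borel_measurable_integrable)
  have \<phi>_eq: "\<phi> t = of_real (indicator {0..} t * (exp (- (c * t)) * f t))" for t
    by (simp add: \<phi>_def exp_of_real[symmetric] scaleR_conv_of_real)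
  have "(\<lambda>t. exp (c * t) * Re (\<phi> t)) \<in> borel_measurable borel" by measurable
  also have "(\<lambda>t. exp (c * t) * Re (\<phi> t)) = (\<lambda>t. indicat_real {0..} t * f t)"
    by (rule ext) (simp only: \<phi>_eq Re_complex_of_real, simp add: exp_minus)
  finally show ?thesis .
qed

lemma laplace_at_one:
  assumes "0 < Re s"
  shows "laplace_at (\<lambda>_. 1) s (1 / s)"
proof -
  have "laplace_at (\<lambda>_. 0) s 0" by (simp add: laplace_at_def has_bochner_integral_zero)
  then obtain F where F: "laplace_at (\<lambda>_. 1) s F" "0 = s * F - 1"
    using laplace_at_derivative[of "\<lambda>_. 1" "\<lambda>_. 0" 1 0 s 0] assms by auto
  have "s \<noteq> 0" using assms by auto
  with F(2) have "F = 1 / s" by (simp add: eq_divide_eq mult.commute)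
  with F(1) show ?thesis by simp
qed

text \<open>For a coordinate \<zeta> of the angles, \<zeta>' is not known to have a transform, so
  the rule for derivatives cannot be applied to it. Instead \<eta> is integrated, and the comparison
  is made between the continuous functions \<zeta> and c times the primitive.\<close>

lemma signal_of_integrated_transform:
  fixes \<zeta> \<zeta>' :: "real \<Rightarrow> real"
  assumes deriv: "\<And>t. 0 \<le> t \<Longrightarrow> (\<zeta> has_real_derivative \<zeta>' t) (at t within {0..})"
    and \<zeta>: "eventually (\<lambda>s. laplace_at (\<lambda>t. of_real (\<zeta> t)) s (c * H s / s)) right_half"
    and cont: "continuous_on {0..} \<eta>" and bound: "\<And>t. 0 \<le> t \<Longrightarrow> norm (\<eta> t) \<le> C * exp (b * t)"
    and \<eta>: "eventually (\<lambda>s. laplace_at \<eta> s (H s)) right_half"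
    and t: "0 \<le> t"
  shows "of_real (\<zeta>' t) = c * \<eta> t"
proof -
  have C: "0 \<le> C" using bound[of 0] order_trans[OF norm_ge_zero] by fastforce
  \<comment> \<open>Integration is the first-order system with r = 0 and \<alpha> = 0. The rate is
    raised to at least 1 so that it lies strictly to the right of this root.\<close>
  have "norm (\<eta> t) \<le> C * exp (max b 1 * t)" if "0 \<le> t" for t
  proof -
    have "C * exp (b * t) \<le> C * exp (max b 1 * t)"
      using C that by (intro mult_left_mono) (auto intro: mult_right_mono)
    then show ?thesis using bound[OF that] by linarith
  qed
  then have "\<exists>y K. continuous_on {0..} y \<and>
      (\<forall>t\<ge>0. (y has_vector_derivative (0 * y t + \<eta> t)) (at t within {0..})) \<and>
      (\<forall>t\<ge>0. norm (y t) \<le> K * exp (max b 1 * t)) \<and>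
      (\<forall>s \<Phi>. max b 1 < Re s \<longrightarrow> laplace_at \<eta> s \<Phi> \<longrightarrow> laplace_at y s ((0 + \<Phi>) / (s - 0)))"
    by (intro first_order_response[where C = C, OF cont]) auto
  then obtain y where y: "continuous_on {0..} y"
      "\<forall>t\<ge>0. (y has_vector_derivative (0 * y t + \<eta> t)) (at t within {0..})"
      "\<forall>s \<Phi>. max b 1 < Re s \<longrightarrow> laplace_at \<eta> s \<Phi> \<longrightarrow> laplace_at y s ((0 + \<Phi>) / (s - 0))"
    by (elim exE conjE)
  have lap: "eventually (\<lambda>s. laplace_at (\<lambda>t. c * y t) s (c * H s / s)) right_half"
    using \<eta> eventually_right_half_gt[of "max b 1"]
    by eventually_elim (use laplace_at_cmult y(3) in fastforce)
  have \<zeta>_deriv: "((\<lambda>t. complex_of_real (\<zeta> t)) has_vector_derivative of_real (\<zeta>' t)) (at t within {0..})"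
    if "0 \<le> t" for t
    using deriv[OF that]
    by (intro has_vector_derivative_of_real) (simp add: has_real_derivative_iff_has_vector_derivative)
  have eq: "of_real (\<zeta> t) = c * y t" if "0 \<le> t" for t
  proof (rule AE_eq_continuous_imp_eq_half_line[OF _ _ laplace_eq_imp_AE_eq[OF \<zeta> lap] that])
    show "continuous_on {0..} (\<lambda>t. complex_of_real (\<zeta> t))"
      using \<zeta>_deriv by (intro continuous_on_vector_derivative) auto
    show "continuous_on {0..} (\<lambda>t. c * y t)" by (intro continuous_intros y(1))
  qed
  have "((\<lambda>t. c * y t) has_vector_derivative (c * \<eta> t)) (at t within {0..})"
    using has_vector_derivative_mult_right[OF y(2)[rule_format, OF t]] by simp
  then have "((\<lambda>t. complex_of_real (\<zeta> t)) has_vector_derivative (c * \<eta> t)) (at t within {0..})"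
    by (rule has_vector_derivative_transform[rotated 2]) (use t eq in auto)
  \<comment> \<open>Restricting to the interval from t to t + 1 makes the derivative unique also at
    t = 0, where it is one-sided.\<close>
  moreover have "cbox t (t + 1) \<subseteq> {0..}" using t by auto
  ultimately show ?thesis
    using \<zeta>_deriv[OF t]
    by (intro vector_derivative_unique_within_closed_interval[of t "t + 1" t])
      (auto intro: has_vector_derivative_within_subset)
qed

text \<open>\<open>eigen\<close> says that the row vector with entries v i k / sqrt (f i), applied
  to \<kappa>, gives lam k times the row vector with entries v j k sqrt (f j). Summed with these
  weights, the bus equations become one scalar loop z = g0 (c / s - lam k z), which is solved for z
  where 1 + lam k g0 is nonzero.\<close>

lemma modal_response:
  fixes v \<kappa> :: "nat \<Rightarrow> nat \<Rightarrow> real" and \<theta> :: "nat \<Rightarrow> real \<Rightarrow> real" and u f lam :: "nat \<Rightarrow> real"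
  assumes f: "\<And>i. i < n \<Longrightarrow> 0 < f i"
    and g0: "real_rational_strictly_proper g0"
    and loop: "\<And>i. i < n \<Longrightarrow>
      transfers (\<lambda>s. of_real (1 / f i) * g0 s) (\<lambda>t. u i - (\<Sum>j<n. \<kappa> i j * \<theta> j t)) (\<theta> i)"
    and eigen: "\<And>j. j < n \<Longrightarrow> (\<Sum>i<n. v i k / sqrt (f i) * \<kappa> i j) = lam k * (v j k * sqrt (f j))"
  shows "eventually (\<lambda>s. laplace_at (\<lambda>t. of_real (\<Sum>i<n. v i k * sqrt (f i) * \<theta> i t)) s
      (of_real (\<Sum>i<n. v i k / sqrt (f i) * u i) * modal_tf g0 (lam k) s / s)) right_half"
proof -
  obtain P Q S where S: "finite S" "\<And>s. s \<notin> S \<Longrightarrow> 1 + of_real (lam k) * g0 s \<noteq> 0"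
    using modal_tf_rational[OF g0, where \<mu> = "lam k"] by metis
  have "\<forall>i\<in>{..<n}. \<exists>X. has_laplace (\<lambda>t. u i - (\<Sum>j<n. \<kappa> i j * \<theta> j t)) X \<and>
      has_laplace (\<theta> i) (\<lambda>s. of_real (1 / f i) * g0 s * X s)"
    using loop by (simp add: transfers_def)
  from bchoice[OF this] obtain X where X: "\<forall>i\<in>{..<n}.
      has_laplace (\<lambda>t. u i - (\<Sum>j<n. \<kappa> i j * \<theta> j t)) (X i) \<and>
      has_laplace (\<theta> i) (\<lambda>s. of_real (1 / f i) * g0 s * X i s)" ..
  have "eventually (\<lambda>s. \<forall>i\<in>{..<n}.
      laplace_at (\<lambda>t. of_real (u i - (\<Sum>j<n. \<kappa> i j * \<theta> j t))) s (X i s)) right_half"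
    "eventually (\<lambda>s. \<forall>i\<in>{..<n}.
      laplace_at (\<lambda>t. of_real (\<theta> i t)) s (of_real (1 / f i) * g0 s * X i s)) right_half"
    using X by (auto intro!: eventually_ball_finite simp: has_laplace_iff_laplace_at)
  with eventually_right_half_not_in_finite[OF S(1)] eventually_right_half_gt[of 0]
  show ?thesis
  proof eventually_elim
    case (elim s)
    define \<Theta> where "\<Theta> = (\<lambda>i. of_real (1 / f i) * g0 s * X i s)"
    have \<Theta>: "laplace_at (\<lambda>t. of_real (\<theta> i t)) s (\<Theta> i)" if "i < n" for i
      using elim(4) that by (simp add: \<Theta>_def)
    \<comment> \<open>\<open>transfers\<close> only asserts that the net input of bus i has some
      transform. Uniqueness identifies it with the one computed from the step and the
      angles.\<close>
    have "X i s = of_real (u i) * (1 / s) - (\<Sum>j<n. of_real (\<kappa> i j) * \<Theta> j)" if "i < n" for i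
    proof -
      have "laplace_at (\<lambda>t. of_real (u i) * 1 - (\<Sum>j<n. of_real (\<kappa> i j) * of_real (\<theta> j t))) s
          (of_real (u i) * (1 / s) - (\<Sum>j<n. of_real (\<kappa> i j) * \<Theta> j))"
        by (intro laplace_at_diff laplace_at_sum laplace_at_cmult \<Theta> laplace_at_one elim(2)) auto
      then show ?thesis
        using elim(3) that by (intro laplace_at_unique[of _ s]) auto
    qed
    note X_eq = this
    define z where "z = (\<Sum>i<n. of_real (v i k * sqrt (f i)) * \<Theta> i)"
    define c where "c = (\<Sum>i<n. v i k / sqrt (f i) * u i)"
    have lap: "laplace_at (\<lambda>t. \<Sum>i<n. of_real (v i k * sqrt (f i)) * of_real (\<theta> i t)) s z"
      unfolding z_def by (intro laplace_at_sum laplace_at_cmult \<Theta>) auto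
    have "(\<Sum>i<n. of_real (v i k / sqrt (f i)) * (\<Sum>j<n. of_real (\<kappa> i j) * \<Theta> j))
        = (\<Sum>j<n. of_real (\<Sum>i<n. v i k / sqrt (f i) * \<kappa> i j) * \<Theta> j)"
      unfolding sum_distrib_left of_real_sum sum_distrib_right
      by (subst sum.swap) (simp add: mult.assoc)
    also have "\<dots> = of_real (lam k) * z"
      unfolding z_def sum_distrib_left by (intro sum.cong refl, subst eigen) (auto simp: mult.assoc)
    finally have network: "(\<Sum>i<n. of_real (v i k / sqrt (f i)) * (\<Sum>j<n. of_real (\<kappa> i j) * \<Theta> j))
        = of_real (lam k) * z" .
    have "z = (\<Sum>i<n. g0 s * (of_real (v i k / sqrt (f i)) * X i s))"
    proof -
      have "sqrt (f i) * (1 / f i) = 1 / sqrt (f i)" if "i < n" for i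
        using f[OF that] by (simp add: field_simps)
      then have "v i k * sqrt (f i) * (1 / f i) = v i k / sqrt (f i)" if "i < n" for i
        using that by (metis mult.assoc times_divide_eq_right mult.right_neutral)
      note weight = this
      have "of_real (v i k * sqrt (f i)) * \<Theta> i = g0 s * (of_real (v i k / sqrt (f i)) * X i s)"
        if "i < n" for i
      proof -
        have "of_real (v i k * sqrt (f i)) * \<Theta> i = of_real (v i k * sqrt (f i) * (1 / f i)) * (g0 s * X i s)"
          unfolding \<Theta>_def of_real_mult by (simp only: mult_ac)
        then show ?thesis unfolding weight[OF that] by (simp only: mult_ac)
      qed
      then show ?thesis by (simp add: z_def)
    qed
    also have "\<dots> = g0 s * (\<Sum>i<n. of_real (v i k / sqrt (f i)) *
        (of_real (u i) * (1 / s) - (\<Sum>j<n. of_real (\<kappa> i j) * \<Theta> j)))"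
      by (simp add: sum_distrib_left X_eq)
    also have "\<dots> = g0 s * (of_real c * (1 / s) - of_real (lam k) * z)"
      unfolding network[symmetric] c_def
      by (simp add: right_diff_distrib sum_subtractf sum_distrib_left sum_distrib_right sum_divide_distrib)
    finally have "z * (1 + of_real (lam k) * g0 s) = of_real c * g0 s / s"
      by (simp add: algebra_simps)
    then have "z = of_real c * g0 s / s / (1 + of_real (lam k) * g0 s)"
      by (rule nonzero_eq_divide_eq[OF S(2)[OF elim(1)], THEN iffD2])
    then have "z = of_real c * modal_tf g0 (lam k) s / s"
      by (simp add: modal_tf_def mult.commute)
    then show ?case using lap unfolding c_def by simp
  qed
qed

section \<open>Integrability of products of modes and their quadratic forms\<close>

lemma set_integrable_mult_exp_decay:
  fixes x y :: "real \<Rightarrow> real"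
  assumes "(\<lambda>t. indicat_real {0..} t * x t) \<in> borel_measurable borel"
    and "(\<lambda>t. indicat_real {0..} t * y t) \<in> borel_measurable borel"
    and x: "AE t in lborel. 0 \<le> t \<longrightarrow> \<bar>x t\<bar> \<le> C * exp (b * t)" and "b < 0"
    and y: "AE t in lborel. 0 \<le> t \<longrightarrow> \<bar>y t\<bar> \<le> D * exp (d * t)" and "d < 0"
  shows "set_integrable lborel {0..} (\<lambda>t. x t * y t)"
  unfolding set_integrable_def
proof (rule Bochner_Integration.integrable_bound)
  show "integrable lborel (\<lambda>t. C * D * (indicat_real {0..} t * exp ((b + d) * t)))"
    using integrable_exp_decay_half_line[of "b + d"] assms by simp
  have "(\<lambda>t. (indicat_real {0..} t * x t) * (indicat_real {0..} t * y t)) \<in> borel_measurable borel"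
    by (intro borel_measurable_times assms)
  also have "(\<lambda>t. (indicat_real {0..} t * x t) * (indicat_real {0..} t * y t))
      = (\<lambda>t. indicat_real {0..} t *\<^sub>R (x t * y t))"
    by (rule ext) (simp add: indicator_def)
  finally show "(\<lambda>t. indicat_real {0..} t *\<^sub>R (x t * y t)) \<in> borel_measurable lborel" by simp
  show "AE t in lborel. norm (indicat_real {0..} t *\<^sub>R (x t * y t))
      \<le> norm (C * D * (indicat_real {0..} t * exp ((b + d) * t)))"
    using x y
  proof eventually_elim
    case (elim t)
    show ?case
    proof (cases "0 \<le> t")
      case True
      have "\<bar>x t\<bar> * \<bar>y t\<bar> \<le> (C * exp (b * t)) * (D * exp (d * t))"
        using elim True by (intro mult_mono) (auto intro: order_trans[OF abs_ge_zero])
      also have "\<dots> = C * D * exp ((b + d) * t)"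
        by (simp add: exp_add distrib_right)
      finally have "\<bar>x t * y t\<bar> \<le> \<bar>C * D * exp ((b + d) * t)\<bar>"
        unfolding abs_mult[of "x t"] by linarith
      then show ?thesis using True by simp
    qed simp
  qed
qed

lemma modal_tf_inverse_decay:
  assumes "real_rational_strictly_proper g0" and h: "has_laplace h (modal_tf g0 \<mu>)"
    and "\<And>s. is_pole (modal_tf g0 \<mu>) s \<Longrightarrow> Re s < 0"
  obtains C b where "b < 0" "AE t in lborel. 0 \<le> t \<longrightarrow> \<bar>h t\<bar> \<le> C * exp (b * t)"
proof -
  obtain \<eta> C b where \<eta>: "continuous_on {0..} \<eta>" "\<And>t. 0 \<le> t \<Longrightarrow> norm (\<eta> t) \<le> C * exp (b * t)"
    "eventually (\<lambda>s. laplace_at \<eta> s (modal_tf g0 \<mu> s)) right_half"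
    "(\<forall>s. is_pole (modal_tf g0 \<mu>) s \<longrightarrow> Re s < 0) \<longrightarrow> b < 0"
    using that by (rule modal_tf_inverse_laplace[OF assms(1)])
  have "AE t in lborel. 0 \<le> t \<longrightarrow> of_real (h t) = \<eta> t"
    by (rule laplace_eq_imp_AE_eq[OF h[unfolded has_laplace_iff_laplace_at] \<eta>(3)])
  then have "AE t in lborel. 0 \<le> t \<longrightarrow> \<bar>h t\<bar> \<le> C * exp (b * t)"
    by eventually_elim (use \<eta>(2) norm_of_real in metis)
  then show thesis using that \<eta>(4) assms(3) by blast
qed

text \<open>Measurability of q is a separate hypothesis because M need not be complete: equality
  almost everywhere with a measurable function does not provide it.\<close>

lemma set_integral_quadratic_form:
  fixes h :: "'i \<Rightarrow> 'a \<Rightarrow> real"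
  assumes int: "\<And>k l. k \<in> I \<Longrightarrow> l \<in> I \<Longrightarrow> set_integrable M S (\<lambda>t. h k t * h l t)"
    and q: "(\<lambda>t. indicat_real S t * q t) \<in> borel_measurable M"
    and AE: "AE t in M. t \<in> S \<longrightarrow> q t = (\<Sum>k\<in>I. \<Sum>l\<in>I. A k l * (h k t * h l t))"
  shows "set_integrable M S q"
    and "(LINT t:S|M. q t) = (\<Sum>k\<in>I. \<Sum>l\<in>I. A k l * (LINT t:S|M. h k t * h l t))"
proof -
  have hb: "has_bochner_integral M (\<lambda>t. \<Sum>k\<in>I. \<Sum>l\<in>I. A k l * (indicat_real S t *\<^sub>R (h k t * h l t)))
      (\<Sum>k\<in>I. \<Sum>l\<in>I. A k l * (LINT t:S|M. h k t * h l t))"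
    using int unfolding set_integrable_def set_lebesgue_integral_def
    by (intro has_bochner_integral_sum has_bochner_integral_mult_right has_bochner_integral_integrable)
  have "AE t in M. (\<Sum>k\<in>I. \<Sum>l\<in>I. A k l * (indicat_real S t *\<^sub>R (h k t * h l t)))
      = indicat_real S t *\<^sub>R q t"
    using AE by eventually_elim (auto simp: indicator_def)
  then have "has_bochner_integral M (\<lambda>t. indicat_real S t *\<^sub>R q t)
      (\<Sum>k\<in>I. \<Sum>l\<in>I. A k l * (LINT t:S|M. h k t * h l t))"
    using q by (intro has_bochner_integral_cong_AE[THEN iffD1, OF borel_measurable_has_bochner_integral[OF hb] _ _ hb]) auto
  then show "set_integrable M S q"
    and "(LINT t:S|M. q t) = (\<Sum>k\<in>I. \<Sum>l\<in>I. A k l * (LINT t:S|M. h k t * h l t))"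
    by (auto simp: set_integrable_def set_lebesgue_integral_def has_bochner_integral_iff)
qed

text \<open>The dimension of \<open>\<theta> t\<close> is fixed only for t \<ge> 0, so the vector
  expression for the net input can be expanded into sums only there; transforms ignore negative
  times.\<close>

lemma transfers_cong:
  assumes "\<And>s. g s = g' s" "\<And>t. 0 \<le> t \<Longrightarrow> x t = x' t" "\<And>t. 0 \<le> t \<Longrightarrow> y t = y' t"
  shows "transfers g x y \<longleftrightarrow> transfers g' x' y'"
proof -
  have "has_laplace x F \<longleftrightarrow> has_laplace x' F" "has_laplace y F \<longleftrightarrow> has_laplace y' F" for F
    using laplace_at_cong[of "\<lambda>t. of_real (x t)" "\<lambda>t. of_real (x' t)"]
      laplace_at_cong[of "\<lambda>t. of_real (y t)" "\<lambda>t. of_real (y' t)"] assms(2,3)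
    by (simp_all add: has_laplace_iff_laplace_at)
  then show ?thesis using assms(1) by (simp add: transfers_def)
qed

section \<open>Orthogonal coordinates and the scaled Laplacian\<close>

lemma sum_lessThan_delta_mult:
  fixes x :: "nat \<Rightarrow> real"
  shows "(\<Sum>i<n. (if i = k then 1 else 0) * x i) = (if k < n then x k else 0)"
  by (simp add: if_distrib[of "\<lambda>c. c * _"] sum.delta cong: if_cong)

lemma orthogonal_mat_columns:
  fixes V :: "real mat"
  assumes "V \<in> carrier_mat n n" "transpose_mat V * V = 1\<^sub>m n" "k < n" "l < n"
  shows "(\<Sum>i<n. V $$ (i, k) * V $$ (i, l)) = (if k = l then 1 else 0)"
proof -
  have "(\<Sum>i<n. V $$ (i, k) * V $$ (i, l)) = (transpose_mat V * V) $$ (k, l)"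
    using assms(1,3,4) by (simp add: scalar_prod_def atLeast0LessThan)
  then show ?thesis using assms by simp
qed

lemma orthogonal_mat_rows:
  fixes V :: "real mat"
  assumes "V \<in> carrier_mat n n" "transpose_mat V * V = 1\<^sub>m n" "i < n" "j < n"
  shows "(\<Sum>k<n. V $$ (i, k) * V $$ (j, k)) = (if i = j then 1 else 0)"
proof -
  have "V * transpose_mat V = 1\<^sub>m n"
    using mat_mult_left_right_inverse[OF _ assms(1,2)] assms(1) by simp
  moreover have "(\<Sum>k<n. V $$ (i, k) * V $$ (j, k)) = (V * transpose_mat V) $$ (i, j)"
    using assms(1,3,4) by (simp add: scalar_prod_def atLeast0LessThan)
  ultimately show ?thesis using assms by simp
qed

text \<open>Multiplying the diagonalization on the left by the k-th eigenvector, transposed, leaves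
  lam k times that row, by orthonormality of the columns. Moving one factor sqrt (f j) across gives
  the form that \<open>modal_response\<close> assumes.\<close>

lemma scaled_laplacian_eigenvector:
  fixes V L :: "real mat"
  assumes f: "\<And>i. i < n \<Longrightarrow> 0 < f i"
    and V: "V \<in> carrier_mat n n" "transpose_mat V * V = 1\<^sub>m n" and L: "L \<in> carrier_mat n n"
    and L_F: "mat_diag n (\<lambda>i. 1 / sqrt (f i)) * L * mat_diag n (\<lambda>i. 1 / sqrt (f i))
      = V * mat_diag n lam * transpose_mat V"
    and k: "k < n" and j: "j < n"
  shows "(\<Sum>i<n. V $$ (i, k) / sqrt (f i) * L $$ (i, j)) = lam k * (V $$ (j, k) * sqrt (f j))"
proof -
  have L_eq: "L $$ (i, j) / sqrt (f i) = sqrt (f j) * (\<Sum>m<n. V $$ (i, m) * lam m * V $$ (j, m))"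
    if i: "i < n" for i
  proof -
    have "1 / sqrt (f i) * L $$ (i, j) * (1 / sqrt (f j))
        = (mat_diag n (\<lambda>i. 1 / sqrt (f i)) * L * mat_diag n (\<lambda>i. 1 / sqrt (f i))) $$ (i, j)"
      using i j L by (simp add: mat_diag_mult_left[of _ n n] mat_diag_mult_right[of _ n n])
    also have "\<dots> = (\<Sum>m<n. V $$ (i, m) * lam m * V $$ (j, m))"
      unfolding L_F using i j V
      by (simp add: mat_diag_mult_right[of _ n n] scalar_prod_def atLeast0LessThan)
    finally show ?thesis using f[OF i] f[OF j] by (simp add: field_simps)
  qed
  have "(\<Sum>i<n. V $$ (i, k) / sqrt (f i) * L $$ (i, j))
      = (\<Sum>i<n. V $$ (i, k) * (sqrt (f j) * (\<Sum>m<n. V $$ (i, m) * lam m * V $$ (j, m))))"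
    by (intro sum.cong refl) (simp add: L_eq[symmetric])
  also have "\<dots> = (\<Sum>m<n. (\<Sum>i<n. V $$ (i, m) * V $$ (i, k)) * (sqrt (f j) * lam m * V $$ (j, m)))"
    unfolding sum_distrib_left sum_distrib_right by (subst sum.swap) (simp add: mult_ac)
  also have "\<dots> = (\<Sum>m<n. (if m = k then 1 else 0) * (sqrt (f j) * lam m * V $$ (j, m)))"
    using k by (intro sum.cong refl) (simp add: orthogonal_mat_columns[OF V])
  also have "\<dots> = lam k * (V $$ (j, k) * sqrt (f j))"
    unfolding sum_lessThan_delta_mult using k by simp
  finally show ?thesis .
qed

text \<open>Both conclusions are used: the relation to \<open>h\<close>, valid off a null set,
  yields the energy, and continuity, which \<open>h\<close> itself need not have, makes
  \<open>w\<close> measurable on the half-line.\<close>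

lemma network_modal_signal:
  fixes V L :: "real mat" and h :: "real \<Rightarrow> real" and \<theta> w :: "real \<Rightarrow> real vec"
  assumes f: "\<And>i. i < n \<Longrightarrow> 0 < f i"
    and g0: "real_rational_strictly_proper g0"
    and g: "\<And>i s. i < n \<Longrightarrow> g i s = complex_of_real (1 / f i) * g0 s"
    and L: "L \<in> carrier_mat n n"
    and V: "V \<in> carrier_mat n n" "transpose_mat V * V = 1\<^sub>m n"
    and L_F: "mat_diag n (\<lambda>i. 1 / sqrt (f i)) * L * mat_diag n (\<lambda>i. 1 / sqrt (f i))
      = V * mat_diag n lam * transpose_mat V"
    and u0: "u0 \<in> carrier_vec n"
    and response: "network_response n g L (step_input u0) \<theta> w"
    and k: "k < n" and h: "has_laplace h (modal_tf g0 (lam k))"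
  shows "continuous_on {0..} (\<lambda>t. \<Sum>i<n. V $$ (i, k) * sqrt (f i) * w t $ i)"
    and "AE t in lborel. 0 \<le> t \<longrightarrow> (\<Sum>i<n. V $$ (i, k) * sqrt (f i) * w t $ i)
      = (\<Sum>i<n. V $$ (i, k) / sqrt (f i) * u0 $ i) * h t"
proof -
  have \<theta>: "\<And>t. 0 \<le> t \<Longrightarrow> \<theta> t \<in> carrier_vec n"
    and loop: "\<And>i. i < n \<Longrightarrow> transfers (g i) (\<lambda>t. (step_input u0 t - L *\<^sub>v \<theta> t) $ i) (\<lambda>t. \<theta> t $ i)"
    and deriv: "\<And>i t. i < n \<Longrightarrow> 0 \<le> t \<Longrightarrow>
      ((\<lambda>\<tau>. \<theta> \<tau> $ i) has_real_derivative w t $ i) (at t within {0..})"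
    using response by (auto simp: network_response_def)
  have "(step_input u0 t - L *\<^sub>v \<theta> t) $ i = u0 $ i - (\<Sum>j<n. L $$ (i, j) * \<theta> t $ j)"
    if "i < n" "0 \<le> t" for i t
    using that \<theta>[of t] u0 L by (simp add: step_input_def scalar_prod_def atLeast0LessThan)
  then have "transfers (g i) (\<lambda>t. (step_input u0 t - L *\<^sub>v \<theta> t) $ i) (\<lambda>t. \<theta> t $ i)
      \<longleftrightarrow> transfers (\<lambda>s. of_real (1 / f i) * g0 s)
        (\<lambda>t. u0 $ i - (\<Sum>j<n. L $$ (i, j) * \<theta> t $ j)) (\<lambda>t. \<theta> t $ i)" if "i < n" for i
    using that by (intro transfers_cong g) auto
  with loop have loop': "transfers (\<lambda>s. of_real (1 / f i) * g0 s)
      (\<lambda>t. u0 $ i - (\<Sum>j<n. L $$ (i, j) * \<theta> t $ j)) (\<lambda>t. \<theta> t $ i)" if "i < n" for i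
    using that by blast
  define c where "c = (\<Sum>i<n. V $$ (i, k) / sqrt (f i) * u0 $ i)"
  have lap: "eventually (\<lambda>s. laplace_at (\<lambda>t. of_real (\<Sum>i<n. V $$ (i, k) * sqrt (f i) * \<theta> t $ i)) s
      (of_real c * modal_tf g0 (lam k) s / s)) right_half"
    unfolding c_def
    using modal_response[where \<theta> = "\<lambda>i t. \<theta> t $ i" and v = "\<lambda>i k. V $$ (i, k)" and lam = lam and k = k,
        OF f g0 loop' scaled_laplacian_eigenvector[OF f V L L_F k]] .
  obtain \<eta> C b where \<eta>: "continuous_on {0..} \<eta>" "\<And>t. 0 \<le> t \<Longrightarrow> norm (\<eta> t) \<le> C * exp (b * t)"
    "eventually (\<lambda>s. laplace_at \<eta> s (modal_tf g0 (lam k) s)) right_half"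
    "(\<forall>s. is_pole (modal_tf g0 (lam k)) s \<longrightarrow> Re s < 0) \<longrightarrow> b < 0"
    using that by (rule modal_tf_inverse_laplace[OF g0])
  have "((\<lambda>t. \<Sum>i<n. V $$ (i, k) * sqrt (f i) * \<theta> t $ i) has_real_derivative
      (\<Sum>i<n. V $$ (i, k) * sqrt (f i) * w t $ i)) (at t within {0..})" if "0 \<le> t" for t
    using deriv that by (intro DERIV_sum DERIV_cmult) auto
  then have signal: "of_real (\<Sum>i<n. V $$ (i, k) * sqrt (f i) * w t $ i) = of_real c * \<eta> t"
    if "0 \<le> t" for t
    by (rule signal_of_integrated_transform[OF _ lap \<eta>(1-3) that])
  have "continuous_on {0..} (\<lambda>t. Re (of_real c * \<eta> t))"
    by (intro continuous_intros \<eta>(1))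
  then show "continuous_on {0..} (\<lambda>t. \<Sum>i<n. V $$ (i, k) * sqrt (f i) * w t $ i)"
    by (rule continuous_on_eq) (simp add: signal[symmetric])
  have "AE t in lborel. 0 \<le> t \<longrightarrow> of_real (h t) = \<eta> t"
    by (rule laplace_eq_imp_AE_eq[OF h[unfolded has_laplace_iff_laplace_at] \<eta>(3)])
  then show "AE t in lborel. 0 \<le> t \<longrightarrow> (\<Sum>i<n. V $$ (i, k) * sqrt (f i) * w t $ i)
      = (\<Sum>i<n. V $$ (i, k) / sqrt (f i) * u0 $ i) * h t"
    unfolding c_def[symmetric]
  proof eventually_elim
    case (elim t)
    show ?case
    proof
      assume "0 \<le> t"
      then have "complex_of_real (\<Sum>i<n. V $$ (i, k) * sqrt (f i) * w t $ i) = of_real (c * h t)"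
        using elim signal by simp
      then show "(\<Sum>i<n. V $$ (i, k) * sqrt (f i) * w t $ i) = c * h t"
        by (simp only: of_real_eq_iff)
    qed
  qed
qed

theorem proposition1:
  fixes n :: nat
    and f :: "nat \<Rightarrow> real"
    and L V :: "real mat"
    and g0 :: "complex \<Rightarrow> complex"
    and g :: "nat \<Rightarrow> complex \<Rightarrow> complex"
    and lam :: "nat \<Rightarrow> real"
    and h :: "nat \<Rightarrow> real \<Rightarrow> real"
    and u0 :: "real vec"
    and \<theta> w :: "real \<Rightarrow> real vec"
    and wbar :: "real \<Rightarrow> real"
  defines "F_inv \<equiv> mat_diag n (\<lambda>i. 1 / f i)"
    and "F_half \<equiv> mat_diag n (\<lambda>i. sqrt (f i))"
    and "F_neg_half \<equiv> mat_diag n (\<lambda>i. 1 / sqrt (f i))"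
    and "V_perp \<equiv> drop_first_col V"
  defines "wtilde \<equiv> (\<lambda>t. w t - wbar t \<cdot>\<^sub>v ones_vec n)"
    and "z0 \<equiv> transpose_mat V_perp *\<^sub>v (F_neg_half *\<^sub>v u0)"
    and "\<Gamma> \<equiv> transpose_mat V_perp * F_inv * V_perp"
  assumes n: "1 \<le> n"
    and f_pos: "\<And>i. i < n \<Longrightarrow> 0 < f i"
    and g0: "real_rational_strictly_proper g0"
    and g: "\<And>i s. i < n \<Longrightarrow> g i s = complex_of_real (1 / f i) * g0 s"
    and L_laplacian: "weighted_graph_laplacian n L"
    and L_sym: "transpose_mat L = L"
    and L_psd: "pos_semidef_mat n L"
    and L_rank: "vec_space.rank n L = n - 1"
    and L_kernel: "mat_kernel L = {c \<cdot>\<^sub>v ones_vec n | c. True}"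
    and V: "V \<in> carrier_mat n n"
    and V_orth: "transpose_mat V * V = 1\<^sub>m n"
    and L_F: "F_neg_half * L * F_neg_half = V * mat_diag n lam * transpose_mat V"
    and lam_0: "lam 0 = 0"
    and lam_pos: "\<And>k. 1 \<le> k \<Longrightarrow> k < n \<Longrightarrow> 0 < lam k"
    and lam_mono: "\<And>k l. 1 \<le> k \<Longrightarrow> k \<le> l \<Longrightarrow> l < n \<Longrightarrow> lam k \<le> lam l"
    and v0: "col V 0 = (1 / sqrt (\<Sum>i<n. f i)) \<cdot>\<^sub>v (F_half *\<^sub>v ones_vec n)"
    and h: "\<And>k. k < n \<Longrightarrow> has_laplace (h k) (modal_tf g0 (lam k))"
    and stable: "\<And>k s. 1 \<le> k \<Longrightarrow> k < n \<Longrightarrow> is_pole (modal_tf g0 (lam k)) s \<Longrightarrow> Re s < 0"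
    and u0: "u0 \<in> carrier_vec n"
    and response: "network_response n g L (step_input u0) \<theta> w"
    and wbar: "has_laplace wbar (\<lambda>s. complex_of_real ((\<Sum>i<n. u0 $ i) / (\<Sum>i<n. f i)) * g0 s)"
  shows "set_integrable lborel {0..} (\<lambda>t. (eucl_norm (wtilde t))\<^sup>2)
    \<and> (\<forall>k\<in>{1..<n}. \<forall>l\<in>{1..<n}. set_integrable lborel {0..} (\<lambda>t. h k t * h l t))
    \<and> (LBINT t:{0..}. (eucl_norm (wtilde t))\<^sup>2) = z0 \<bullet> (gram_weighted n \<Gamma> h *\<^sub>v z0)"
proof -
  define m where "m = n - 1"
  define S where "S = (\<Sum>i<n. f i)"
  define c where "c = (\<lambda>k. \<Sum>i<n. V $$ (i, k) / sqrt (f i) * u0 $ i)"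
  define mode where "mode = (\<lambda>k t. \<Sum>i<n. V $$ (i, k) * sqrt (f i) * w t $ i)"
  define q where "q = (\<lambda>t. (eucl_norm (wtilde t))\<^sup>2)"
  have nm: "n = Suc m" using n by (simp add: m_def)
  have L: "L \<in> carrier_mat n n" using L_psd by (simp add: pos_semidef_mat_def)
  have S: "0 < S" unfolding S_def using n f_pos by (intro sum_pos) (auto simp: lessThan_empty_iff)
  have w_dim: "dim_vec (w t) = n" if "0 \<le> t" for t
    using response that by (auto simp: network_response_def)
  have mode_cont: "continuous_on {0..} (mode k)"
    and mode_AE: "AE t in lborel. 0 \<le> t \<longrightarrow> mode k t = c k * h k t" if "k < n" for k
    unfolding mode_def c_def
    by (rule network_modal_signal[OF f_pos g0 g L V V_orth L_F[unfolded F_neg_half_def] u0 response that h[OF that]];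
        assumption)+
  \<comment> \<open>Inverse change of coordinates: the modes are V^T F^(1/2) w, and V V^T is the
    identity.\<close>
  have w_eq: "w t $ i = (\<Sum>k<n. V $$ (i, k) * mode k t) / sqrt (f i)" if i: "i < n" for i t
  proof -
    have "(\<Sum>k<n. V $$ (i, k) * mode k t)
        = (\<Sum>j<n. (\<Sum>k<n. V $$ (j, k) * V $$ (i, k)) * (sqrt (f j) * w t $ j))"
      unfolding mode_def sum_distrib_left sum_distrib_right by (subst sum.swap) (simp add: mult_ac)
    also have "\<dots> = (\<Sum>j<n. (if j = i then 1 else 0) * (sqrt (f j) * w t $ j))"
      using i by (intro sum.cong refl) (simp add: orthogonal_mat_rows[OF V V_orth])
    also have "\<dots> = sqrt (f i) * w t $ i"
      unfolding sum_lessThan_delta_mult using i by simp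
    finally show ?thesis using f_pos[OF i] by simp
  qed
  \<comment> \<open>After division by sqrt (f i) this entry no longer depends on i, so mode 0 moves
    all buses alike.\<close>
  have V0: "V $$ (i, 0) = sqrt (f i) / sqrt S" if "i < n" for i
  proof -
    have "V $$ (i, 0) = col V 0 $ i" using that V n by simp
    also have "\<dots> = sqrt (f i) / sqrt S"
      using that unfolding v0
      by (simp add: F_half_def ones_vec_def mat_diag_def scalar_prod_def S_def if_distrib[of "\<lambda>x. x * _"] cong: if_cong)
    finally show ?thesis .
  qed
  have c0: "c 0 = (\<Sum>i<n. u0 $ i) / sqrt S"
    unfolding c_def sum_divide_distrib
    by (intro sum.cong refl) (use f_pos in \<open>force simp: V0\<close>)
  \<comment> \<open>The eigenvalue 0 removes the feedback, so \<open>h 0\<close> inverts g0 itself,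
    and \<open>wbar\<close> is almost everywhere a multiple of it.\<close>
  have "modal_tf g0 (lam 0) = g0" by (rule ext) (simp add: modal_tf_def lam_0)
  then have "has_laplace (h 0) g0" using h[of 0] n by simp
  then have "eventually (\<lambda>s. laplace_at (\<lambda>t. of_real ((\<Sum>i<n. u0 $ i) / S) * of_real (h 0 t)) s
      (of_real ((\<Sum>i<n. u0 $ i) / S) * g0 s)) right_half"
    unfolding has_laplace_iff_laplace_at by (rule eventually_mono) (rule laplace_at_cmult)
  then have "AE t in lborel. 0 \<le> t \<longrightarrow>
      complex_of_real (wbar t) = of_real ((\<Sum>i<n. u0 $ i) / S) * of_real (h 0 t)"
    by (rule laplace_eq_imp_AE_eq[OF wbar[folded S_def, unfolded has_laplace_iff_laplace_at]])
  then have wbar_AE: "AE t in lborel. 0 \<le> t \<longrightarrow> wbar t = (\<Sum>i<n. u0 $ i) / S * h 0 t"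
    unfolding of_real_mult[symmetric] of_real_eq_iff .
  have "AE t in lborel. \<forall>k\<in>{..<n}. 0 \<le> t \<longrightarrow> mode k t = c k * h k t"
    by (rule AE_finite_allI) (use mode_AE in auto)
  with wbar_AE have dev_AE: "AE t in lborel. 0 \<le> t \<longrightarrow> (\<forall>i<n.
      w t $ i - wbar t = (\<Sum>k<m. V $$ (i, Suc k) * c (Suc k) * h (Suc k) t) / sqrt (f i))"
  proof eventually_elim
    case (elim t)
    have "w t $ i - wbar t = (\<Sum>k<m. V $$ (i, Suc k) * c (Suc k) * h (Suc k) t) / sqrt (f i)"
      if t: "0 \<le> t" and i: "i < n" for i
    proof -
      have "(\<Sum>k<n. V $$ (i, k) * mode k t) = (\<Sum>k<n. V $$ (i, k) * c k * h k t)"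
        using elim(2) t by (intro sum.cong refl) (simp add: mult.assoc)
      also have "\<dots> = V $$ (i, 0) * c 0 * h 0 t + (\<Sum>k<m. V $$ (i, Suc k) * c (Suc k) * h (Suc k) t)"
        unfolding nm by (rule sum.lessThan_Suc_shift)
      \<comment> \<open>The two factors 1 / sqrt S, one from the column of V and one from
        \<open>c 0\<close>, combine to the 1 / S of the system frequency.\<close>
      also have "V $$ (i, 0) * c 0 * h 0 t = sqrt (f i) * wbar t"
        using elim(1) t S by (simp add: V0[OF i] c0)
      finally have "w t $ i = (sqrt (f i) * wbar t
          + (\<Sum>k<m. V $$ (i, Suc k) * c (Suc k) * h (Suc k) t)) / sqrt (f i)"
        by (simp only: w_eq[OF i])
      then show ?thesis using f_pos[OF i] by (simp add: add_divide_distrib)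
    qed
    then show ?case by blast
  qed
  have q_sum: "q t = (\<Sum>i<n. (w t $ i - wbar t)\<^sup>2)" if "0 \<le> t" for t
    using w_dim[OF that]
    by (simp add: q_def eucl_norm_def wtilde_def ones_vec_def L2_set_def sum_nonneg atLeast0LessThan)
  \<comment> \<open>Column k of \<open>V_perp\<close> is column Suc k of V, whence the shift in
    \<open>c\<close> and \<open>h\<close> below. For n = 1 there is no such column and all sums over
    k < m are empty.\<close>
  have Vp: "V_perp \<in> carrier_mat n m" "\<And>i k. i < n \<Longrightarrow> k < m \<Longrightarrow> V_perp $$ (i, k) = V $$ (i, Suc k)"
    using V by (auto simp: V_perp_def drop_first_col_def m_def)
  have "transpose_mat V_perp * F_inv = Matrix.mat m n (\<lambda>(k, i). transpose_mat V_perp $$ (k, i) * (1 / f i))"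
    unfolding F_inv_def using Vp(1) by (intro mat_diag_mult_right) simp
  then have \<Gamma>: "\<Gamma> $$ (k, l) = (\<Sum>i<n. V $$ (i, Suc k) * V $$ (i, Suc l) / f i)" if "k < m" "l < m" for k l
    using that Vp by (simp add: \<Gamma>_def scalar_prod_def atLeast0LessThan)
  have z0: "z0 \<in> carrier_vec m" "\<And>k. k < m \<Longrightarrow> z0 $ k = c (Suc k)"
  proof -
    define x where "x = F_neg_half *\<^sub>v u0"
    have x: "x \<in> carrier_vec n" "\<And>i. i < n \<Longrightarrow> x $ i = u0 $ i / sqrt (f i)"
      using u0 by (auto intro!: mult_mat_vec_carrier[of _ n n] simp: x_def F_neg_half_def mat_diag_def
          scalar_prod_def if_distrib[of "\<lambda>x. x * _"] cong: if_cong)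
    show "z0 \<in> carrier_vec m"
      unfolding z0_def x_def[symmetric] using Vp(1) x(1) by (intro mult_mat_vec_carrier[of _ m n]) auto
    show "z0 $ k = c (Suc k)" if "k < m" for k
      unfolding z0_def x_def[symmetric] c_def
      using that Vp x by (simp add: scalar_prod_def atLeast0LessThan)
  qed
  have q_AE: "AE t in lborel. t \<in> {0..} \<longrightarrow>
      q t = (\<Sum>k<m. \<Sum>l<m. (z0 $ k * \<Gamma> $$ (k, l) * z0 $ l) * (h (Suc k) t * h (Suc l) t))"
    using dev_AE
  proof eventually_elim
    case (elim t)
    have "q t = (\<Sum>k<m. \<Sum>l<m. (z0 $ k * \<Gamma> $$ (k, l) * z0 $ l) * (h (Suc k) t * h (Suc l) t))"
      if t: "0 \<le> t"
    proof -
      \<comment> \<open>\<open>a i k\<close> is sqrt (f i) times the share of mode Suc k in the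
        deviation at bus i. Expanding the square and summing over the buses first collects the
        products of entries of V, weighted by 1 / f i, into \<open>\<Gamma>\<close>.\<close>
      define a where "a = (\<lambda>i k. V $$ (i, Suc k) * c (Suc k) * h (Suc k) t)"
      have "q t = (\<Sum>i<n. (\<Sum>k<m. a i k)\<^sup>2 / f i)"
        unfolding q_sum[OF t] using elim t f_pos
        by (intro sum.cong refl) (simp add: a_def power_divide less_imp_le)
      also have "\<dots> = (\<Sum>i<n. \<Sum>k<m. \<Sum>l<m. a i k * a i l / f i)"
        by (simp add: power2_eq_square sum_product sum_divide_distrib)
      also have "\<dots> = (\<Sum>k<m. \<Sum>l<m. \<Sum>i<n. a i k * a i l / f i)"
        by (subst sum.swap) (intro sum.cong refl sum.swap)
      also have "\<dots> = (\<Sum>k<m. \<Sum>l<m. (z0 $ k * \<Gamma> $$ (k, l) * z0 $ l) * (h (Suc k) t * h (Suc l) t))"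
        by (intro sum.cong refl)
          (simp add: \<Gamma> z0(2) a_def sum_distrib_left sum_distrib_right mult_ac)
      finally show ?thesis .
    qed
    then show ?case by simp
  qed
  have h_meas: "(\<lambda>t. indicat_real {0..} t * h k t) \<in> borel_measurable borel" if "k < n" for k
    by (rule has_laplace_measurable[OF h[OF that]])
  have hh: "set_integrable lborel {0..} (\<lambda>t. h k t * h l t)" if k: "k \<in> {1..<n}" and l: "l \<in> {1..<n}" for k l
  proof -
    have decay: "\<exists>C b. b < 0 \<and> (AE t in lborel. 0 \<le> t \<longrightarrow> \<bar>h k t\<bar> \<le> C * exp (b * t))" if "k \<in> {1..<n}" for k
    proof -
      have "has_laplace (h k) (modal_tf g0 (lam k))" "\<And>s. is_pole (modal_tf g0 (lam k)) s \<Longrightarrow> Re s < 0"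
        using h stable that by auto
      from modal_tf_inverse_decay[OF g0 this] show ?thesis by blast
    qed
    obtain C b where kb: "b < 0" "AE t in lborel. 0 \<le> t \<longrightarrow> \<bar>h k t\<bar> \<le> C * exp (b * t)"
      using decay[OF k] by blast
    obtain D d where ld: "d < 0" "AE t in lborel. 0 \<le> t \<longrightarrow> \<bar>h l t\<bar> \<le> D * exp (d * t)"
      using decay[OF l] by blast
    show ?thesis
      using k l by (intro set_integrable_mult_exp_decay[OF _ _ kb(2,1) ld(2,1)] h_meas) auto
  qed
  \<comment> \<open>The two ingredients are measurable for different reasons: \<open>w\<close> is a
    combination of continuous modes on the half-line, while \<open>wbar\<close> is measurable only
    because it has a transform.\<close>
  have q_meas: "(\<lambda>t. indicat_real {0..} t * q t) \<in> borel_measurable lborel"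
  proof -
    have wbar_meas: "(\<lambda>t. indicat_real {0..} t * wbar t) \<in> borel_measurable borel"
      by (rule has_laplace_measurable[OF wbar])
    have w_meas: "(\<lambda>t. indicat_real {0..} t * w t $ i) \<in> borel_measurable borel" if "i < n" for i
    proof -
      have "continuous_on {0..} (\<lambda>t. w t $ i)"
        unfolding w_eq[OF that] using mode_cont f_pos[OF that] by (intro continuous_intros) auto
      then show ?thesis
        using borel_measurable_continuous_on_indicator[of "{0..}" "\<lambda>t. w t $ i"] by simp
    qed
    have "(\<lambda>t. \<Sum>i<n. (indicat_real {0..} t * w t $ i - indicat_real {0..} t * wbar t)\<^sup>2)
        \<in> borel_measurable borel"
      by (intro borel_measurable_sum borel_measurable_power borel_measurable_diff wbar_meas w_meas) auto
    also have "(\<lambda>t. \<Sum>i<n. (indicat_real {0..} t * w t $ i - indicat_real {0..} t * wbar t)\<^sup>2)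
        = (\<lambda>t. indicat_real {0..} t * q t)"
      by (rule ext) (auto simp: indicator_def q_sum)
    finally show ?thesis by simp
  qed
  have hh': "set_integrable lborel {0..} (\<lambda>t. h (Suc k) t * h (Suc l) t)" if "k \<in> {..<m}" "l \<in> {..<m}" for k l
    using that nm by (intro hh) auto
  note energy = set_integral_quadratic_form[where I = "{..<m}" and h = "\<lambda>k. h (Suc k)", OF hh' q_meas q_AE]
  have "(LBINT t:{0..}. q t) = (\<Sum>k<m. \<Sum>l<m. (z0 $ k * \<Gamma> $$ (k, l) * z0 $ l) *
      (LBINT t:{0..}. h (Suc k) t * h (Suc l) t))"
    by (rule energy(2))
  also have "\<dots> = z0 \<bullet> (gram_weighted n \<Gamma> h *\<^sub>v z0)"
    unfolding gram_weighted_def m_def[symmetric] using z0(1)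
    by (simp add: scalar_prod_def atLeast0LessThan sum_distrib_left mult_ac)
  finally show ?thesis
    using energy(1) hh unfolding q_def by blast
qed

end
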